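(* Let $A$ be a central simple $F$-algebra of degree $n\ge1$. Let $I_1,\dots,I_n\subset A_s$ be right ideals of $F_s$-dimension $n$ such that the set $\{I_1,\dots,I_n\}$ is stable under $\Gamma$ and $I_1+\cdots+I_n=A_s$. Let $$L_s=\{x\in A_s\mid xI_i\subset I_i\ \text{ for } 1\le i\le n\},$$ an $F_s$-subalgebra of $A_s$ stable under $\Gamma$, and let $L=L_s^\Gamma$ be the $F$-subalgebra of $\Gamma$-fixed elements. Then $L$ is an étale $F$-algebra of dimension $n$, and $\{I_1,\dots,I_n\}$ is the image of the general embedding $\varepsilon_*\colon\mathbf{X}(L)\hookrightarrow\mathcal{SB}(A)$ induced by the inclusion $\varepsilon\colon L\hookrightarrow A$.
   Context: $F$ is an arbitrary field, $F_s$ a separable closure of $F$, $\Gamma=\operatorname{Gal}(F_s/F)$, $A_s=A\otimes_FF_s$ with $\Gamma$ acting through the second factor, and $A=A_s^\Gamma$ is viewed inside $A_s$. An étale $F$-algebra of dimension $n$ is a commutative $F$-algebra $L$ with $L\otimes_FF_s\cong F_s^n$. The set $\mathbf{X}(L)=\operatorname{Hom}_{F\text{-alg}}(L,F_s)$ carries the $\Gamma$-action $({}^\gamma\xi)(\ell)=\gamma(\xi(\ell))$. $\mathcal{SB}(A)$ is the $(n-1)$-dimensional projective space over $F_s$ whose $(k-1)$-dimensional linear varieties are the right ideals of $A_s$ of dimension $nk$ (so its points are the $n$-dimensional right ideals), with the $\Gamma$-action induced from $A_s$. A general embedding of a $\Gamma$-set $X$ of $n$ elements in $\mathcal{SB}(A)$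 is an injective $\Gamma$-equivariant map from $X$ to the points of $\mathcal{SB}(A)$ whose image is not contained in a proper linear subspace. For an $F$-algebra embedding $\varepsilon\colon L\hookrightarrow A$ of an étale $F$-algebra of dimension $n$, the induced general embedding $\varepsilon_*$ is $$\varepsilon_*(\xi)=\{x\in A_s\mid (1\otimes\xi(\ell))\cdot x=(\varepsilon(\ell)\otimes1)\cdot x\ \text{ for all }\ell\in L\},\qquad \xi\in\mathbf{X}(L).$$ *)

theory Defs
  imports
    "HOL-Analysis.Finite_Cartesian_Product"
    "HOL-Computational_Algebra.Computational_Algebra"
    "HOL-Library.FuncSet"
    "HOL-Library.Poly_Mapping"
begin

section \<open>Separable closures and Galois groups\<close>

text \<open>A field extension is given by a (necessarily injective) unital ring homomorphism
  \<open>\<phi> :: 'f \<Rightarrow> 'k\<close> between fields.\<close>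

definition field_embedding :: "('f::field \<Rightarrow> 'k::field) \<Rightarrow> bool" where
  "field_embedding \<phi> \<longleftrightarrow>
     \<phi> 1 = 1 \<and> (\<forall>x y. \<phi> (x + y) = \<phi> x + \<phi> y) \<and> (\<forall>x y. \<phi> (x * y) = \<phi> x * \<phi> y)"

definition separable_poly :: "'f::field poly \<Rightarrow> bool" where
  "separable_poly p \<longleftrightarrow> coprime p (pderiv p)"

text \<open>The irreducible polynomial in the second clause is, up to a unit, the minimal polynomial of
  \<open>x\<close>, so this clause says that the extension is algebraic and separable.\<close>

definition separable_closure :: "('f::field \<Rightarrow> 'k::field) \<Rightarrow> bool" where
  "separable_closure \<phi> \<longleftrightarrow>
     field_embedding \<phi> \<and>
     (\<forall>x. \<exists>p. irreducible p \<and> separable_poly p \<and> poly (map_poly \<phi> p) x = 0) \<and>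
     (\<forall>q :: 'k poly. separable_poly q \<and> degree q > 0 \<longrightarrow> (\<exists>x. poly q x = 0))"

definition galois_group :: "('f::field \<Rightarrow> 'k::field) \<Rightarrow> ('k \<Rightarrow> 'k) set" where
  "galois_group \<phi> = {\<gamma>. field_embedding \<gamma> \<and> bij \<gamma> \<and> (\<forall>r. \<gamma> (\<phi> r) = \<phi> r)}"


section \<open>Algebras over a field\<close>

definition algebra_over :: "('f::field \<Rightarrow> 'a::ring_1 \<Rightarrow> 'a) \<Rightarrow> bool" where
  "algebra_over sc \<longleftrightarrow>
     vector_space sc \<and>
     (\<forall>r x y. sc r x * y = sc r (x * y)) \<and> (\<forall>r x y. x * sc r y = sc r (x * y))"

definition subalgebra :: "('f::field \<Rightarrow> 'a::ring_1 \<Rightarrow> 'a) \<Rightarrow> 'a set \<Rightarrow> bool" where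
  "subalgebra sc L \<longleftrightarrow> module.subspace sc L \<and> 1 \<in> L \<and> (\<forall>x\<in>L. \<forall>y\<in>L. x * y \<in> L)"

definition algebra_hom_on ::
  "('f::field \<Rightarrow> 'a::ring_1 \<Rightarrow> 'a) \<Rightarrow> ('f \<Rightarrow> 'b::ring_1 \<Rightarrow> 'b) \<Rightarrow> 'a set \<Rightarrow> ('a \<Rightarrow> 'b) \<Rightarrow> bool" where
  "algebra_hom_on sc sc' L h \<longleftrightarrow>
     h 1 = 1 \<and>
     (\<forall>x\<in>L. \<forall>y\<in>L. h (x + y) = h x + h y) \<and>
     (\<forall>x\<in>L. \<forall>y\<in>L. h (x * y) = h x * h y) \<and>
     (\<forall>r. \<forall>x\<in>L. h (sc r x) = sc' r (h x))"

definition right_ideal :: "'a::ring_1 set \<Rightarrow> bool" where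
  "right_ideal J \<longleftrightarrow> 0 \<in> J \<and> (\<forall>x\<in>J. \<forall>y\<in>J. x + y \<in> J) \<and> (\<forall>x\<in>J. \<forall>y. x * y \<in> J)"

definition two_sided_ideal :: "'a::ring_1 set \<Rightarrow> bool" where
  "two_sided_ideal J \<longleftrightarrow> right_ideal J \<and> (\<forall>x\<in>J. \<forall>y. y * x \<in> J)"

definition central_simple_algebra :: "('f::field \<Rightarrow> 'a::ring_1 \<Rightarrow> 'a) \<Rightarrow> bool" where
  "central_simple_algebra sc \<longleftrightarrow>
     algebra_over sc \<and>
     (\<exists>B. finite B \<and> module.span sc B = UNIV) \<and>
     {z. \<forall>x. z * x = x * z} = range (\<lambda>r. sc r 1) \<and>
     (\<forall>J :: 'a set. two_sided_ideal J \<longrightarrow> J = {0} \<or> J = UNIV)"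

definition central_simple_of_degree :: "('f::field \<Rightarrow> 'a::ring_1 \<Rightarrow> 'a) \<Rightarrow> nat \<Rightarrow> bool" where
  "central_simple_of_degree sc n \<longleftrightarrow>
     central_simple_algebra sc \<and> vector_space.dim sc (UNIV :: 'a set) = n\<^sup>2"


section \<open>Scalar extension of an algebra\<close>

text \<open>The usual presentation of \<open>L \<otimes>\<^sub>F K\<close>: the free abelian group on \<open>L \<times> K\<close> modulo the subgroup
  generated by the following elements.\<close>

definition tensor_relations ::
  "('f::field \<Rightarrow> 'k::field) \<Rightarrow> ('f \<Rightarrow> 'a::ring_1 \<Rightarrow> 'a) \<Rightarrow> 'a set \<Rightarrow> ('a \<times> 'k \<Rightarrow>\<^sub>0 int) set" where
  "tensor_relations \<phi> sc L =
     {frag_of (a + b, c) - frag_of (a, c) - frag_of (b, c) | a b c. a \<in> L \<and> b \<in> L} \<union>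
     {frag_of (a, c + d) - frag_of (a, c) - frag_of (a, d) | a c d. a \<in> L} \<union>
     {frag_of (sc r a, c) - frag_of (a, \<phi> r * c) | r a c. a \<in> L}"

definition tensor_eval :: "('a \<Rightarrow> 'k \<Rightarrow> 't::ring_1) \<Rightarrow> ('a \<times> 'k \<Rightarrow>\<^sub>0 int) \<Rightarrow> 't" where
  "tensor_eval tn z = (\<Sum>p\<in>Poly_Mapping.keys z. of_int (Poly_Mapping.lookup z p) * tn (fst p) (snd p))"

text \<open>Since the quotient depends on \<open>\<phi>\<close> and \<open>sc\<close>, it cannot be a type. Instead, we say that
  the ring \<open>'t\<close> together with \<open>tn a c = a \<otimes> c\<close> is the tensor product \<open>L \<otimes>\<^sub>F K\<close> of the \<open>F\<close>-algebra \<open>L\<close>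
  and the extension field \<open>K\<close>: the canonical map from the free abelian group on \<open>L \<times> K\<close> to \<open>'t\<close> is
  onto with kernel generated by the relations, and the product is
  \<open>(a \<otimes> c) (b \<otimes> d) = ab \<otimes> cd\<close>. The values of \<open>tn\<close> outside \<open>L\<close> are irrelevant.\<close>

definition is_tensor_algebra ::
  "('f::field \<Rightarrow> 'k::field) \<Rightarrow> ('f \<Rightarrow> 'a::ring_1 \<Rightarrow> 'a) \<Rightarrow> 'a set \<Rightarrow> ('a \<Rightarrow> 'k \<Rightarrow> 't::ring_1) \<Rightarrow> bool" where
  "is_tensor_algebra \<phi> sc L tn \<longleftrightarrow>
     tensor_eval tn ` {z. Poly_Mapping.keys z \<subseteq> L \<times> UNIV} = UNIV \<and>
     {z. Poly_Mapping.keys z \<subseteq> L \<times> UNIV \<and> tensor_eval tn z = 0} = group_closure (tensor_relations \<phi> sc L) \<and>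
     tn 1 1 = 1 \<and>
     (\<forall>a\<in>L. \<forall>b\<in>L. \<forall>c d. tn a c * tn b d = tn (a * b) (c * d))"

text \<open>The \<open>K\<close>-algebra structure on \<open>L \<otimes>\<^sub>F K\<close>, and its restriction to \<open>F\<close>.\<close>

definition ext_scale :: "('a::ring_1 \<Rightarrow> 'k::field \<Rightarrow> 't::ring_1) \<Rightarrow> 'k \<Rightarrow> 't \<Rightarrow> 't" where
  "ext_scale tn c x = tn 1 c * x"

definition restr_scale ::
  "('f::field \<Rightarrow> 'k::field) \<Rightarrow> ('a::ring_1 \<Rightarrow> 'k \<Rightarrow> 't::ring_1) \<Rightarrow> 'f \<Rightarrow> 't \<Rightarrow> 't" where
  "restr_scale \<phi> tn r = ext_scale tn (\<phi> r)"

text \<open>The action of \<open>\<gamma>\<close> through the second factor.\<close>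

definition galois_act :: "('a::ring_1 \<Rightarrow> 'k::field \<Rightarrow> 't::ring_1) \<Rightarrow> ('k \<Rightarrow> 'k) \<Rightarrow> 't \<Rightarrow> 't" where
  "galois_act tn \<gamma> =
     (THE g. (\<forall>x y. g (x + y) = g x + g y) \<and> (\<forall>a c. g (tn a c) = tn a (\<gamma> c)))"

definition galois_fixed ::
  "('f::field \<Rightarrow> 'k::field) \<Rightarrow> ('a::ring_1 \<Rightarrow> 'k \<Rightarrow> 't::ring_1) \<Rightarrow> 't set \<Rightarrow> 't set" where
  "galois_fixed \<phi> tn S = {x\<in>S. \<forall>\<gamma>\<in>galois_group \<phi>. galois_act tn \<gamma> x = x}"


section \<open>Etale algebras\<close>

text \<open>The subset \<open>L\<close> of an ambient \<open>F\<close>-algebra is an etale \<open>F\<close>-algebra of dimension \<open>CARD('n)\<close>: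
  \<open>L \<otimes>\<^sub>F K\<close> is isomorphic, as a \<open>K\<close>-algebra, to the product algebra \<open>'k ^ 'n\<close> (with componentwise
  multiplication). The last condition says that the isomorphism is \<open>K\<close>-linear. Here \<open>\<phi>\<close> is a
  separable closure of \<open>F\<close>.\<close>

definition etale_algebra ::
  "'n::finite itself \<Rightarrow> ('f::field \<Rightarrow> 'k::field) \<Rightarrow> ('f \<Rightarrow> 'l::ring_1 \<Rightarrow> 'l) \<Rightarrow> 'l set \<Rightarrow> bool" where
  "etale_algebra _ \<phi> sc L \<longleftrightarrow>
     algebra_over sc \<and> subalgebra sc L \<and> (\<forall>x\<in>L. \<forall>y\<in>L. x * y = y * x) \<and>
     (\<exists>t :: 'l \<Rightarrow> 'k \<Rightarrow> 'k ^ 'n. is_tensor_algebra \<phi> sc L t \<and> (\<forall>c. t 1 c = vec c))"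

text \<open>\<open>X(L)\<close>, with homomorphisms taken as extensional functions on \<open>L\<close>. An element \<open>\<gamma>\<close> of the Galois
  group acts on it by \<open>\<xi> \<mapsto> compose L \<gamma> \<xi>\<close>.\<close>

definition alg_points ::
  "('f::field \<Rightarrow> 'k::field) \<Rightarrow> ('f \<Rightarrow> 'l::ring_1 \<Rightarrow> 'l) \<Rightarrow> 'l set \<Rightarrow> ('l \<Rightarrow> 'k) set" where
  "alg_points \<phi> sc L = {\<xi> \<in> extensional L. algebra_hom_on sc (\<lambda>r c. \<phi> r * c) L \<xi>}"


section \<open>Severi-Brauer varieties and general embeddings\<close>

text \<open>Below, \<open>'t\<close> with \<open>tn\<close> is the scalar extension \<open>A \<otimes>\<^sub>F K\<close> of a central simple algebra \<open>A\<close> of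
  degree \<open>n\<close>. The linear varieties of projective dimension \<open>k - 1\<close>:\<close>

definition SB_linear ::
  "('a::ring_1 \<Rightarrow> 'k::field \<Rightarrow> 't::ring_1) \<Rightarrow> nat \<Rightarrow> nat \<Rightarrow> 't set set" where
  "SB_linear tn n k = {J. right_ideal J \<and> vector_space.dim (ext_scale tn) J = n * k}"

abbreviation SB_points ::
  "('a::ring_1 \<Rightarrow> 'k::field \<Rightarrow> 't::ring_1) \<Rightarrow> nat \<Rightarrow> 't set set" where
  "SB_points tn n \<equiv> SB_linear tn n 1"

text \<open>A point \<open>I\<close> lies on the linear variety \<open>J\<close> iff \<open>I \<subseteq> J\<close>; the whole space is \<open>UNIV\<close>.\<close>

definition general_embedding ::
  "('f::field \<Rightarrow> 'k::field) \<Rightarrow> ('a::ring_1 \<Rightarrow> 'k \<Rightarrow> 't::ring_1) \<Rightarrow> nat \<Rightarrow>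
   'x set \<Rightarrow> (('k \<Rightarrow> 'k) \<Rightarrow> 'x \<Rightarrow> 'x) \<Rightarrow> ('x \<Rightarrow> 't set) \<Rightarrow> bool" where
  "general_embedding \<phi> tn n X act f \<longleftrightarrow>
     finite X \<and> card X = n \<and>
     f ` X \<subseteq> SB_points tn n \<and>
     inj_on f X \<and>
     (\<forall>\<gamma>\<in>galois_group \<phi>. \<forall>\<xi>\<in>X. act \<gamma> \<xi> \<in> X \<and> f (act \<gamma> \<xi>) = galois_act tn \<gamma> ` f \<xi>) \<and>
     (\<forall>k. \<forall>J\<in>SB_linear tn n k. J \<noteq> UNIV \<longrightarrow> \<not> (\<forall>\<xi>\<in>X. f \<xi> \<subseteq> J))"

definition induced_embedding ::
  "('a::ring_1 \<Rightarrow> 'k::field \<Rightarrow> 't::ring_1) \<Rightarrow> 'l set \<Rightarrow> ('l \<Rightarrow> 'a) \<Rightarrow> ('l \<Rightarrow> 'k) \<Rightarrow> 't set" where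
  "induced_embedding tn L \<epsilon> \<xi> = {x. \<forall>l\<in>L. tn 1 (\<xi> l) * x = tn (\<epsilon> l) 1 * x}"

end

theory Submission
  imports Defs "HOL-Analysis.Cartesian_Space"
begin

text \<open>
  By dimension count, \<open>A\<^sub>s\<close> is the direct sum of the \<open>I\<^sub>i\<close>; write \<open>1 = \<Sum>e\<^sub>i\<close> with \<open>e\<^sub>i \<in> I\<^sub>i\<close>. Since \<open>A\<^sub>s\<close> is
  simple, right multiplication embeds it in the linear endomorphisms of \<open>I\<^sub>i\<close>, and by dimension count
  this is an isomorphism; hence a left multiplication that preserves \<open>I\<^sub>i\<close> acts on it as a scalar, and
  \<open>L\<^sub>s\<close> is the span of the orthogonal idempotents \<open>e\<^sub>i\<close>, that is, a product of \<open>n\<close> copies of \<open>F\<^sub>s\<close>. By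
  Galois descent \<open>L\<close> spans \<open>L\<^sub>s\<close>, and by linear disjointness \<open>L \<otimes> F\<^sub>s = L\<^sub>s\<close>, so the homomorphisms
  \<open>L \<rightarrow> F\<^sub>s\<close> are the \<open>n\<close> coordinate maps \<open>\<xi>\<^sub>i\<close>, and \<open>I\<^sub>i = e\<^sub>i A\<^sub>s\<close> is the eigenspace of \<open>\<xi>\<^sub>i\<close>.
  That the fixed field of the possibly infinite group \<open>\<Gamma>\<close> is \<open>F\<close> is proved by extending partial
  embeddings with Zorn's lemma.
\<close>

text \<open>No isomorphism of \<open>A_s\<close> with a matrix algebra is available beforehand. The
  given ideals replace it: a single one has dimension n and serves as the module on which
  \<open>A_s\<close> acts from the right, and n^2 on both sides makes the action onto once it is
  faithful. Simplicity of \<open>A_s\<close> enters only there, through the annihilator of an ideal.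
  As the group may be infinite, averaging over it is impossible; descent works with vectors of
  minimal support and needs only that the fixed field is F. The tensor product is not a type but a
  property of a map \<open>tn\<close>, so every map out of it starts from a \<open>balanced\<close>
  function, and K^n is recognized as a scalar extension of L by reducing formal sums to a basis.
  Finally, the idempotents \<open>e i\<close> need not be fixed by the group, so they lie in
  \<open>Ls\<close> but in general not in \<open>L\<close>; facts about them are reached from
  \<open>L\<close> only by K-linear extension.\<close>

section \<open>Separable polynomials and field embeddings\<close>

lemma bezout_div_exists:
  fixes p q :: "'a::field poly"
  shows "\<exists>u v. (u * p + v * q) dvd p \<and> (u * p + v * q) dvd q"
\<comment> \<open>The measure puts the zero polynomial strictly below the nonzero constants, so the
  last division step, with remainder 0, also decreases it.\<close>
proof (induction q arbitrary: p rule: measure_induct_rule[where f = "\<lambda>q. if q = 0 then 0 else Suc (degree q)"])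
  case (less q)
  show ?case
  proof (cases "q = 0")
    case True
    then show ?thesis by (intro exI[of _ 1] exI[of _ 0]) auto
  next
    case False
    let ?r = "p mod q"
    have "(if ?r = 0 then 0 else Suc (degree ?r)) < (if q = 0 then 0 else Suc (degree q))"
      using False degree_mod_less[of q p] by auto
    from less[OF this, of q] obtain u v
      where uv: "(u * q + v * ?r) dvd q" "(u * q + v * ?r) dvd ?r" by blast
    have eq: "u * q + v * ?r = v * p + (u - v * (p div q)) * q"
      by (simp add: minus_div_mult_eq_mod[symmetric] algebra_simps)
    have "(u * q + v * ?r) dvd (p div q) * q + ?r" using uv by (intro dvd_add dvd_mult)
    then have "(u * q + v * ?r) dvd p" by simp
    then show ?thesis using uv(1) unfolding eq by blast
  qed
qed

text \<open>Coprimality is traded for an identity because an identity can be regrouped for a factor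
  and can be pushed through a field embedding.\<close>

lemma separable_poly_bezout:
  assumes "separable_poly p"
  obtains u v where "u * p + v * pderiv p = 1"
proof -
  obtain u v where uv: "(u * p + v * pderiv p) dvd p" "(u * p + v * pderiv p) dvd pderiv p"
    using bezout_div_exists[of p "pderiv p"] by blast
  have "coprime p (pderiv p)" using assms by (simp add: separable_poly_def)
  then have "(u * p + v * pderiv p) dvd 1" using uv coprime_common_divisor by blast
  then obtain w where "1 = (u * p + v * pderiv p) * w" by (rule dvdE)
  then have "(w * u) * p + (w * v) * pderiv p = 1" by (simp add: algebra_simps)
  then show ?thesis by (rule that)
qed

lemma separable_poly_if_bezout:
  assumes "u * p + v * pderiv p = 1"
  shows "separable_poly p"
  unfolding separable_poly_def
proof (rule coprimeI)
  fix c assume "c dvd p" "c dvd pderiv p"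
  then have "c dvd u * p + v * pderiv p" by (intro dvd_add dvd_mult)
  then show "is_unit c" using assms by simp
qed

lemma separable_poly_factor:
  assumes "separable_poly (m * s)"
  shows "separable_poly m"
proof -
  obtain u v where "u * (m * s) + v * pderiv (m * s) = 1"
    using separable_poly_bezout[OF assms] .
  then have "(u * s + v * pderiv s) * m + (v * s) * pderiv m = 1"
    by (simp add: pderiv_mult algebra_simps)
  then show ?thesis by (rule separable_poly_if_bezout)
qed

text \<open>At a double root the polynomial and its derivative both vanish, so a Bezout identity
  would evaluate to 0 there.\<close>

lemma separable_poly_no_double_root:
  assumes "separable_poly (([:-x, 1:] :: 'k::field poly) * h)"
  shows "poly h x \<noteq> 0"
proof
  assume h: "poly h x = 0"
  obtain u v where uv: "u * ([:-x, 1:] * h) + v * pderiv ([:-x, 1:] * h) = 1"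
    using separable_poly_bezout[OF assms] .
  have "poly (u * ([:-x, 1:] * h) + v * pderiv ([:-x, 1:] * h)) x = 0"
    unfolding pderiv_mult poly_add poly_mult h by (simp add: pderiv_pCons)
  then show False unfolding uv by simp
qed

lemma
  assumes "field_embedding \<phi>"
  shows field_embedding_1: "\<phi> 1 = 1"
    and field_embedding_add: "\<phi> (x + y) = \<phi> x + \<phi> y"
    and field_embedding_mult: "\<phi> (x * y) = \<phi> x * \<phi> y"
    and field_embedding_0: "\<phi> 0 = 0"
    and field_embedding_minus: "\<phi> (- x) = - \<phi> x"
    and field_embedding_diff: "\<phi> (x - y) = \<phi> x - \<phi> y"
    and field_embedding_sum: "\<phi> (sum f S) = (\<Sum>i\<in>S. \<phi> (f i))"
    and field_embedding_of_nat: "\<phi> (of_nat n) = of_nat n"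
proof -
  show 1: "\<phi> 1 = 1" and add: "\<phi> (x + y) = \<phi> x + \<phi> y" and "\<phi> (x * y) = \<phi> x * \<phi> y" for x y
    using assms by (auto simp: field_embedding_def)
  have "\<phi> 0 + \<phi> 0 = \<phi> 0 + 0" using add[of 0 0] by simp
  then show 0: "\<phi> 0 = 0" by (simp only: add_left_cancel)
  show minus: "\<phi> (- x) = - \<phi> x" for x
    using add[of "-x" x] 0 by (simp add: eq_neg_iff_add_eq_0)
  show "\<phi> (x - y) = \<phi> x - \<phi> y" using add[of x "-y"] minus[of y] by simp
  show "\<phi> (sum f S) = (\<Sum>i\<in>S. \<phi> (f i))"
    by (induction S rule: infinite_finite_induct) (auto simp: 0 add)
  show "\<phi> (of_nat n) = of_nat n" by (induction n) (auto simp: 0 1 add)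
qed

lemma field_embedding_eq_0_iff:
  assumes "field_embedding \<phi>"
  shows "\<phi> x = 0 \<longleftrightarrow> x = 0"
proof
  assume *: "\<phi> x = 0"
  show "x = 0"
  proof (rule ccontr)
    assume "x \<noteq> 0"
    then have "\<phi> 1 = \<phi> x * \<phi> (inverse x)" using field_embedding_mult[OF assms, of x "inverse x"] by simp
    then show False using * field_embedding_1[OF assms] by simp
  qed
qed (simp add: field_embedding_0[OF assms])

lemma field_embedding_inj: "field_embedding \<phi> \<Longrightarrow> inj \<phi>"
  by (metis (no_types, lifting) injI field_embedding_diff field_embedding_eq_0_iff right_minus_eq)

lemma
  assumes "field_embedding \<phi>"
  shows map_poly_embedding_coeff: "coeff (map_poly \<phi> p) i = \<phi> (coeff p i)"
    and map_poly_embedding_eq_0_iff: "map_poly \<phi> p = 0 \<longleftrightarrow> p = 0"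
    and map_poly_embedding_add: "map_poly \<phi> (p + q) = map_poly \<phi> p + map_poly \<phi> q"
    and map_poly_embedding_mult: "map_poly \<phi> (p * q) = map_poly \<phi> p * map_poly \<phi> q"
    and map_poly_embedding_pderiv: "map_poly \<phi> (pderiv p) = pderiv (map_poly \<phi> p)"
    and map_poly_embedding_1: "map_poly \<phi> 1 = 1"
    and map_poly_embedding_pCons: "map_poly \<phi> (pCons a p) = pCons (\<phi> a) (map_poly \<phi> p)"
proof -
  show 1: "coeff (map_poly \<phi> p) i = \<phi> (coeff p i)" for p i
    using field_embedding_0[OF assms] by (simp add: coeff_map_poly)
  show "map_poly \<phi> p = 0 \<longleftrightarrow> p = 0"
    using field_embedding_eq_0_iff[OF assms] 1 by (metis coeff_0 leading_coeff_0_iff poly_eqI)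
  show "map_poly \<phi> (p + q) = map_poly \<phi> p + map_poly \<phi> q"
    by (rule poly_eqI) (simp add: 1 field_embedding_add[OF assms])
  show "map_poly \<phi> (p * q) = map_poly \<phi> p * map_poly \<phi> q"
    by (rule poly_eqI) (simp add: 1 coeff_mult field_embedding_mult[OF assms] field_embedding_sum[OF assms])
  show "map_poly \<phi> (pderiv p) = pderiv (map_poly \<phi> p)"
    by (rule poly_eqI)
      (simp only: 1 coeff_pderiv field_embedding_mult[OF assms] field_embedding_of_nat[OF assms])
  show "map_poly \<phi> 1 = 1" "map_poly \<phi> (pCons a p) = pCons (\<phi> a) (map_poly \<phi> p)"
    by (rule poly_eqI;
        simp add: 1 coeff_pCons field_embedding_0[OF assms] field_embedding_1[OF assms] split: nat.split)+
qed

lemma separable_poly_map_poly: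
  assumes "field_embedding \<phi>" and "separable_poly p"
  shows "separable_poly (map_poly \<phi> p)"
proof -
  obtain u v where "u * p + v * pderiv p = 1" using separable_poly_bezout[OF assms(2)] .
  then have "map_poly \<phi> (u * p + v * pderiv p) = map_poly \<phi> 1" by simp
  then have "map_poly \<phi> u * map_poly \<phi> p + map_poly \<phi> v * pderiv (map_poly \<phi> p) = 1"
    by (simp add: map_poly_embedding_add[OF assms(1)] map_poly_embedding_mult[OF assms(1)]
        map_poly_embedding_pderiv[OF assms(1)] map_poly_embedding_1[OF assms(1)])
  then show ?thesis by (rule separable_poly_if_bezout)
qed

lemma poly_map_poly_embedding:
  assumes "field_embedding \<gamma>" and "\<And>r. \<gamma> (\<phi> r) = \<phi> r" and "field_embedding \<phi>"
  shows "poly (map_poly \<phi> p) (\<gamma> z) = \<gamma> (poly (map_poly \<phi> p) z)"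
  by (induction p)
    (simp_all add: map_poly_embedding_pCons[OF assms(3)] field_embedding_0[OF assms(1)]
      field_embedding_add[OF assms(1)] field_embedding_mult[OF assms(1)] assms(2))

text \<open>The embedding maps the finite root set of a polynomial over F injectively into itself,
  hence onto itself, and every element lies in such a set.\<close>

lemma embedding_over_bij:
  assumes phi: "field_embedding \<phi>"
    and alg: "\<And>x. \<exists>p. p \<noteq> 0 \<and> poly (map_poly \<phi> p) x = 0"
    and gam: "field_embedding \<gamma>" "\<And>r. \<gamma> (\<phi> r) = \<phi> r"
  shows "bij \<gamma>"
proof (rule bijI)
  show "inj \<gamma>" using gam(1) by (rule field_embedding_inj)
  have "\<exists>x. \<gamma> x = z" for z
  proof -
    obtain p where p: "p \<noteq> 0" "poly (map_poly \<phi> p) z = 0" using alg by blast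
    let ?Z = "{w. poly (map_poly \<phi> p) w = 0}"
    have fin: "finite ?Z" using p(1) map_poly_embedding_eq_0_iff[OF phi] by (simp add: poly_roots_finite)
    have "\<gamma> ` ?Z \<subseteq> ?Z"
      by (auto simp: poly_map_poly_embedding[OF gam phi] field_embedding_0[OF gam(1)])
    then have "\<gamma> ` ?Z = ?Z"
      using fin \<open>inj \<gamma>\<close> by (meson endo_inj_surj inj_on_subset subset_UNIV)
    moreover have "z \<in> ?Z" using p by simp
    ultimately show ?thesis by (metis (no_types, lifting) imageE)
  qed
  then show "surj \<gamma>" unfolding surj_def by metis
qed

section \<open>The fixed field of the Galois group\<close>

text \<open>A partial embedding is represented by its graph; algebraicity makes its domain a field.\<close>

definition partial_embedding :: "('f::field \<Rightarrow> 'k::field) \<Rightarrow> ('k \<times> 'k) set \<Rightarrow> bool" where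
  "partial_embedding \<phi> R \<longleftrightarrow>
     (\<forall>r. (\<phi> r, \<phi> r) \<in> R) \<and>
     (\<forall>x x' y y'. (x, x') \<in> R \<longrightarrow> (y, y') \<in> R \<longrightarrow> (x + y, x' + y') \<in> R \<and> (x * y, x' * y') \<in> R) \<and>
     (\<forall>y. (0, y) \<in> R \<longrightarrow> y = 0)"

text \<open>Since \<open>R\<close> is defined on part of the field only, a polynomial and its image
  are handled as a related pair instead of by mapping coefficients. The degrees of the two are not
  compared.\<close>

definition poly_rel :: "('k::field \<times> 'k) set \<Rightarrow> 'k poly \<Rightarrow> 'k poly \<Rightarrow> bool" where
  "poly_rel R f g \<longleftrightarrow> (\<forall>i. (coeff f i, coeff g i) \<in> R)"

locale partial_emb =
  fixes \<phi> :: "'f::field \<Rightarrow> 'k::field" and R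
  assumes phi: "field_embedding \<phi>" and R: "partial_embedding \<phi> R"
begin

lemma R_base: "(\<phi> r, \<phi> r) \<in> R"
  and R_add: "(x, x') \<in> R \<Longrightarrow> (y, y') \<in> R \<Longrightarrow> (x + y, x' + y') \<in> R"
  and R_mult: "(x, x') \<in> R \<Longrightarrow> (y, y') \<in> R \<Longrightarrow> (x * y, x' * y') \<in> R"
  and R_0D: "(0, y) \<in> R \<Longrightarrow> y = 0"
  using R unfolding partial_embedding_def by blast+

lemma R_0: "(0, 0) \<in> R" and R_1: "(1, 1) \<in> R"
  using R_base[of 0] R_base[of 1] field_embedding_0[OF phi] field_embedding_1[OF phi] by auto

lemma R_minus: "(x, x') \<in> R \<Longrightarrow> (- x, - x') \<in> R"
  using R_mult[OF R_base[of "-1"], of x x'] field_embedding_minus[OF phi, of 1] field_embedding_1[OF phi]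
  by simp

lemma R_diff: "(x, x') \<in> R \<Longrightarrow> (y, y') \<in> R \<Longrightarrow> (x - y, x' - y') \<in> R"
  using R_add[OF _ R_minus, of x x' y y'] by simp

text \<open>\<open>partial_embedding\<close> demands single-valuedness at 0 only; subtraction
  spreads it to all arguments.\<close>

lemma R_unique: "(x, y) \<in> R \<Longrightarrow> (x, z) \<in> R \<Longrightarrow> y = z"
  using R_diff[of x y x z] R_0D[of "y - z"] by simp

lemma R_sum: "(\<And>i. i \<in> S \<Longrightarrow> (f i, g i) \<in> R) \<Longrightarrow> (sum f S, sum g S) \<in> R"
  by (induction S rule: infinite_finite_induct) (auto intro: R_0 R_add)

lemma poly_rel_add: "poly_rel R f f' \<Longrightarrow> poly_rel R g g' \<Longrightarrow> poly_rel R (f + g) (f' + g')"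
  and poly_rel_diff: "poly_rel R f f' \<Longrightarrow> poly_rel R g g' \<Longrightarrow> poly_rel R (f - g) (f' - g')"
  and poly_rel_mult: "poly_rel R f f' \<Longrightarrow> poly_rel R g g' \<Longrightarrow> poly_rel R (f * g) (f' * g')"
  and poly_rel_monom: "(a, a') \<in> R \<Longrightarrow> poly_rel R (monom a k) (monom a' k)"
  and poly_rel_smult: "(a, a') \<in> R \<Longrightarrow> poly_rel R f f' \<Longrightarrow> poly_rel R (smult a f) (smult a' f')"
  and poly_rel_0: "poly_rel R 0 0"
  by (auto simp: poly_rel_def coeff_mult R_0 intro!: R_add R_diff R_mult R_sum)

lemma poly_rel_map_poly: "poly_rel R (map_poly \<phi> p) (map_poly \<phi> p)"
  by (simp add: poly_rel_def map_poly_embedding_coeff[OF phi] R_base)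

lemma poly_rel_0D: "poly_rel R 0 f \<Longrightarrow> f = 0"
  unfolding poly_rel_def by (auto intro!: poly_eqI R_0D)

lemma poly_rel_poly:
  assumes "poly_rel R f f'" "(x, x') \<in> R"
  shows "(poly f x, poly f' x') \<in> R"
proof -
  \<comment> \<open>The degrees of \<open>f\<close> and \<open>f'\<close> are not known to agree; a
    common bound \<open>n\<close> turns both values into sums over the same index set.\<close>
  have "\<And>g g'. poly_rel R g g' \<Longrightarrow> degree g \<le> n \<Longrightarrow> degree g' \<le> n \<Longrightarrow> (poly g x, poly g' x') \<in> R" for n
  proof -
    have pw: "(x ^ i, x' ^ i) \<in> R" for i by (induction i) (auto intro: R_1 R_mult assms(2))
    fix g g' assume g: "poly_rel R g g'" "degree g \<le> n" "degree g' \<le> n"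
    have "poly h y = (\<Sum>i\<le>n. coeff h i * y ^ i)" if "degree h \<le> n" for h :: "'k poly" and y
      unfolding poly_altdef using that
      by (intro sum.mono_neutral_left) (auto simp: coeff_eq_0)
    then show "(poly g x, poly g' x') \<in> R"
      using g by (auto simp: poly_rel_def intro!: R_sum R_mult pw)
  qed
  then show ?thesis using assms(1) by (meson linorder_linear order_trans order_refl)
qed

text \<open>Long division by the monic \<open>m\<close>, carried out in parallel on the image side
  with the same exponents, so that quotient and remainder stay related. The remainder is bounded
  through its coefficients, which keeps a zero remainder from being a special case. Nothing is
  claimed on the size of \<open>r'\<close>; later \<open>r = 0\<close> forces
  \<open>r' = 0\<close>.\<close>

lemma poly_rel_division:
  assumes m: "poly_rel R m m'" "coeff m d = 1" "degree m = d" and f: "poly_rel R f f'"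
  obtains s s' r r' where "poly_rel R s s'" "poly_rel R r r'" "f = m * s + r" "f' = m' * s' + r'"
    "\<And>i. i \<ge> d \<Longrightarrow> coeff r i = 0"
proof -
  have "\<exists>s s' r r'. poly_rel R s s' \<and> poly_rel R r r' \<and> f = m * s + r \<and> f' = m' * s' + r' \<and>
      (\<forall>i\<ge>d. coeff r i = 0)" if "\<forall>i\<ge>N. coeff f i = 0" "poly_rel R f f'" for N f f'
    using that
  proof (induction N arbitrary: f f')
    case 0
    then show ?case using poly_rel_0 by (metis add_0 le0 mult_zero_right)
  next
    case (Suc N)
    show ?case
    proof (cases "Suc N \<le> d")
      case True
      then have "\<forall>i\<ge>d. coeff f i = 0" using Suc.prems(1) by auto
      then show ?thesis using poly_rel_0 Suc.prems(2) by (metis add_0 mult_zero_right)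
    next
      case False
      let ?q = "monom (coeff f N) (N - d)" and ?q' = "monom (coeff f' N) (N - d)"
      have q: "poly_rel R ?q ?q'" using Suc.prems(2) by (intro poly_rel_monom) (auto simp: poly_rel_def)
      have "poly_rel R (f - m * ?q) (f' - m' * ?q')"
        by (intro poly_rel_diff poly_rel_mult q Suc.prems(2) m(1))
      moreover have "\<forall>i\<ge>N. coeff (f - m * ?q) i = 0"
      proof (intro allI impI)
        fix i assume i: "N \<le> i"
        have c: "coeff (m * ?q) i = coeff f N * coeff m (i - (N - d))"
          using i by (simp add: mult.commute[of m] coeff_monom_mult)
        show "coeff (f - m * ?q) i = 0"
        proof (cases "i = N")
          case True
          then show ?thesis using c False m(2) by simp
        next
          case ne: False
          then have "coeff m (i - (N - d)) = 0" using i False m(3) by (intro coeff_eq_0) auto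
          then show ?thesis using c Suc.prems(1) i ne by simp
        qed
      qed
      ultimately obtain s s' r r' where
        IH: "poly_rel R s s'" "poly_rel R r r'" "f - m * ?q = m * s + r" "f' - m' * ?q' = m' * s' + r'"
          "\<forall>i\<ge>d. coeff r i = 0" using Suc.IH by blast
      have "f = m * (s + ?q) + r" "f' = m' * (s' + ?q') + r'" using IH(3,4) by (simp_all add: algebra_simps)
      then show ?thesis using IH(2,5) poly_rel_add[OF IH(1) q] by blast
    qed
  qed
  from this[of "Suc (degree f)" f f'] f that show thesis
    by (metis Suc_le_lessD coeff_eq_0)
qed

end

locale algebraic_partial_emb = partial_emb +
  assumes alg: "\<And>x. \<exists>p. p \<noteq> 0 \<and> poly (map_poly \<phi> p) x = 0"
begin

text \<open>If an annihilating polynomial has constant term 0, cancelling \<open>z\<close> leaves a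
  smaller one; otherwise z p(z) = -a can be divided by the constant term a. Having the inverse as a
  polynomial over F in \<open>z\<close> is what lets \<open>R_inverse\<close> transport it to the
  image of \<open>z\<close>.\<close>

lemma inverse_polynomial:
  assumes "z \<noteq> 0"
  shows "\<exists>q. z * poly (map_poly \<phi> q) z = 1"
proof -
  have "\<exists>q. z * poly (map_poly \<phi> q) z = 1" if "p \<noteq> 0" "poly (map_poly \<phi> p) z = 0" for p
    using that
  proof (induction p)
    case (pCons a p)
    show ?case
    proof (cases "a = 0")
      case True
      then show ?thesis
        using pCons assms by (simp add: map_poly_embedding_pCons[OF phi] field_embedding_0[OF phi])
    next
      case False
      have "poly (map_poly \<phi> (smult (- inverse a) p)) z = \<phi> (- inverse a) * poly (map_poly \<phi> p) z"
        using map_poly_embedding_mult[OF phi, of "[:- inverse a:]" p]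
        by (simp add: map_poly_embedding_pCons[OF phi])
      moreover have "z * poly (map_poly \<phi> p) z = - \<phi> a"
        using pCons.prems(2) by (simp add: map_poly_embedding_pCons[OF phi] eq_neg_iff_add_eq_0 add.commute)
      ultimately have "z * poly (map_poly \<phi> (smult (- inverse a) p)) z = \<phi> (- inverse a) * (- \<phi> a)"
        by (metis mult.left_commute)
      also have "\<dots> = \<phi> (- inverse a * (- a))"
        using field_embedding_mult[OF phi] field_embedding_minus[OF phi] by metis
      also have "\<dots> = 1" using False by (simp add: field_embedding_1[OF phi])
      finally show ?thesis by blast
    qed
  qed simp
  then show ?thesis using alg by blast
qed

lemma R_inverse:
  assumes "(z, w) \<in> R" "z \<noteq> 0"
  shows "(inverse z, inverse w) \<in> R"
proof -
  obtain q where q: "z * poly (map_poly \<phi> q) z = 1" using inverse_polynomial[OF assms(2)] by blast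
  have *: "(poly (map_poly \<phi> q) z, poly (map_poly \<phi> q) w) \<in> R"
    using poly_rel_map_poly assms(1) by (rule poly_rel_poly)
  have "w * poly (map_poly \<phi> q) w = 1"
    using R_mult[OF assms(1) *] q R_1 R_unique by metis
  then show ?thesis using q * by (metis inverse_unique)
qed

text \<open>A nonzero polynomial of least degree among the first components of related pairs, made
  monic. Its partner \<open>m'\<close> is carried along because divisibility must hold
  simultaneously on both sides: this is what makes sending \<open>x\<close> to a root of
  \<open>m'\<close> well defined.\<close>

lemma minimal_polynomial:
  obtains m m' where "poly_rel R m m'" "lead_coeff m = 1" "degree m > 0" "poly m x = 0"
    "\<And>f f'. poly_rel R f f' \<Longrightarrow> poly f x = 0 \<Longrightarrow> \<exists>s s'. poly_rel R s s' \<and> f = m * s \<and> f' = m' * s'"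
proof -
  define M where "M d \<longleftrightarrow> (\<exists>m m'. poly_rel R m m' \<and> m \<noteq> 0 \<and> degree m = d \<and> poly m x = 0)" for d
  have "\<exists>d. M d"
    using alg[of x] poly_rel_map_poly map_poly_embedding_eq_0_iff[OF phi] unfolding M_def by blast
  then have L: "M (LEAST d. M d)" and least: "\<And>d. M d \<Longrightarrow> (LEAST d. M d) \<le> d"
    by (auto intro: LeastI Least_le)
  define d where "d = (LEAST d. M d)"
  obtain m0 m0' where m0: "poly_rel R m0 m0'" "m0 \<noteq> 0" "degree m0 = d" "poly m0 x = 0"
    using L unfolding d_def[symmetric] unfolding M_def by blast
  define m where "m = smult (inverse (lead_coeff m0)) m0"
  \<comment> \<open>The coefficient at \<open>d\<close>, not the leading one: it is the element
    related to the leading coefficient of \<open>m0\<close>, whatever the degree of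
    \<open>m0'\<close>.\<close>
  define m' where "m' = smult (inverse (coeff m0' d)) m0'"
  have "(inverse (lead_coeff m0), inverse (coeff m0' d)) \<in> R"
    using m0 by (intro R_inverse) (auto simp: poly_rel_def)
  then have m: "poly_rel R m m'" unfolding m_def m'_def using m0(1) by (rule poly_rel_smult)
  have lc: "coeff m d = 1" "degree m = d" "poly m x = 0"
    using m0 by (auto simp: m_def)
  have "d \<noteq> 0"
  proof
    assume "d = 0"
    then obtain c where "m = [:c:]" using lc(2) degree_eq_zeroE by blast
    then show False using lc \<open>d = 0\<close> by simp
  qed
  moreover have "\<exists>s s'. poly_rel R s s' \<and> f = m * s \<and> f' = m' * s'"
    if f: "poly_rel R f f'" "poly f x = 0" for f f'
  proof -
    obtain s s' r r' where sr: "poly_rel R s s'" "poly_rel R r r'" "f = m * s + r" "f' = m' * s' + r'"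
      "\<And>i. i \<ge> d \<Longrightarrow> coeff r i = 0"
      using poly_rel_division[OF m lc(1,2) f(1)] by metis
    have "poly r x = 0" using f(2) lc(3) sr(3) by simp
    have "r = 0"
    proof (rule ccontr)
      assume "r \<noteq> 0"
      then have "M (degree r)" using sr(2) \<open>poly r x = 0\<close> unfolding M_def by blast
      then have "d \<le> degree r" using least d_def by simp
      then show False using sr(5) \<open>r \<noteq> 0\<close> by (meson leading_coeff_0_iff)
    qed
    then show ?thesis using sr poly_rel_0D[of r'] by auto
  qed
  ultimately show thesis using that[of m m'] m lc by auto
qed

text \<open>Adjoin \<open>x\<close> by pairing the values of related polynomials at \<open>x\<close>
  and at \<open>y\<close>. Only the clause at 0 is not formal: if f(x) = 0 then \<open>m\<close>
  divides \<open>f\<close>, hence \<open>m'\<close> divides \<open>f'\<close>, and f'(y) =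
  0.\<close>

lemma extend_partial_embedding:
  assumes m: "poly_rel R m m'"
    "\<And>f f'. poly_rel R f f' \<Longrightarrow> poly f x = 0 \<Longrightarrow> \<exists>s s'. poly_rel R s s' \<and> f = m * s \<and> f' = m' * s'"
    and y: "poly m' y = 0"
  obtains R' where "partial_embedding \<phi> R'" "R \<subseteq> R'" "(x, y) \<in> R'"
proof -
  let ?R = "{(poly f x, poly f' y) | f f'. poly_rel R f f'}"
  have sub: "R \<subseteq> ?R"
  proof clarify
    fix a b assume "(a, b) \<in> R"
    then have "poly_rel R [:a:] [:b:]" by (auto simp: poly_rel_def coeff_pCons R_0 split: nat.split)
    moreover have "(a, b) = (poly [:a:] x, poly [:b:] y)" by simp
    ultimately show "\<exists>f f'. (a, b) = (poly f x, poly f' y) \<and> poly_rel R f f'" by blast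
  qed
  have "poly_rel R [:0, 1:] [:0, 1:]" by (auto simp: poly_rel_def coeff_pCons R_0 R_1 split: nat.split)
  moreover have "(x, y) = (poly [:0, 1:] x, poly [:0, 1:] y)" by simp
  ultimately have xy: "(x, y) \<in> ?R" by blast
  have "partial_embedding \<phi> ?R" unfolding partial_embedding_def
  proof (intro conjI allI impI)
    show "(\<phi> r, \<phi> r) \<in> ?R" for r using sub R_base by blast
    fix a a' b b' assume "(a, a') \<in> ?R" "(b, b') \<in> ?R"
    then obtain f f' g g' where fg: "poly_rel R f f'" "a = poly f x" "a' = poly f' y"
      "poly_rel R g g'" "b = poly g x" "b' = poly g' y" by blast
    have "a + b = poly (f + g) x" "a' + b' = poly (f' + g') y"
      "a * b = poly (f * g) x" "a' * b' = poly (f' * g') y" using fg by simp_all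
    then show "(a + b, a' + b') \<in> ?R" "(a * b, a' * b') \<in> ?R"
      using poly_rel_add[OF fg(1,4)] poly_rel_mult[OF fg(1,4)] by blast+
  next
    fix z assume "(0, z) \<in> ?R"
    then obtain f f' where "poly_rel R f f'" "poly f x = 0" "z = poly f' y" by force
    then show "z = 0" using m(2)[of f f'] y by auto
  qed
  then show thesis using that sub xy by blast
qed

end

context
  fixes \<phi> :: "'f::field \<Rightarrow> 'k::field"
  assumes sep: "separable_closure \<phi>"
begin

lemma separable_closure_embedding: "field_embedding \<phi>"
  using sep by (simp add: separable_closure_def)

lemma separable_closure_poly:
  obtains p where "p \<noteq> 0" "separable_poly (map_poly \<phi> p)" "poly (map_poly \<phi> p) x = 0"
proof -
  obtain p where p: "separable_poly p" "poly (map_poly \<phi> p) x = 0" "irreducible p"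
    using sep unfolding separable_closure_def by blast
  then have "p \<noteq> 0" by auto
  then show thesis using that[of p] p separable_poly_map_poly separable_closure_embedding by blast
qed

lemma separable_closure_root:
  assumes "separable_poly q" "degree q > 0"
  obtains x where "poly q x = (0 :: 'k)"
  using assms sep unfolding separable_closure_def by blast

lemma algebraic_partial_embI: "partial_embedding \<phi> R \<Longrightarrow> algebraic_partial_emb \<phi> R"
  by unfold_locales (use separable_closure_embedding separable_closure_poly in blast)+

lemma partial_embedding_extends:
  assumes "partial_embedding \<phi> R0"
  obtains \<gamma> where "\<gamma> \<in> galois_group \<phi>" "\<And>x y. (x, y) \<in> R0 \<Longrightarrow> \<gamma> x = y"
proof -
  let ?A = "{R. partial_embedding \<phi> R \<and> R0 \<subseteq> R}"
  have "\<exists>M\<in>?A. \<forall>X\<in>?A. M \<subseteq> X \<longrightarrow> X = M"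
  proof (rule subset_Zorn_nonempty)
    show "?A \<noteq> {}" using assms by blast
    fix C assume C: "C \<noteq> {}" "subset.chain ?A C"
    then have mem: "\<And>R. R \<in> C \<Longrightarrow> partial_embedding \<phi> R \<and> R0 \<subseteq> R"
      and tot: "\<And>R S. R \<in> C \<Longrightarrow> S \<in> C \<Longrightarrow> R \<subseteq> S \<or> S \<subseteq> R"
      unfolding subset.chain_def by blast+
    have "partial_embedding \<phi> (\<Union>C)" unfolding partial_embedding_def
    proof (intro conjI allI impI)
      show "(\<phi> r, \<phi> r) \<in> \<Union>C" for r using C(1) mem unfolding partial_embedding_def by blast
      show "z = 0" if "(0, z) \<in> \<Union>C" for z using that mem unfolding partial_embedding_def by blast
      fix a a' b b' assume "(a, a') \<in> \<Union>C" "(b, b') \<in> \<Union>C"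
      then obtain R where R: "R \<in> C" "(a, a') \<in> R" "(b, b') \<in> R" using tot by (meson UnionE subsetD)
      then have "(a + b, a' + b') \<in> R \<and> (a * b, a' * b') \<in> R"
        using mem unfolding partial_embedding_def by blast
      then show "(a + b, a' + b') \<in> \<Union>C" "(a * b, a' * b') \<in> \<Union>C" using R(1) by auto
    qed
    then show "\<Union>C \<in> ?A" using C(1) mem by blast
  qed
  then obtain R where "R \<in> ?A" and R_max: "\<forall>X\<in>?A. R \<subseteq> X \<longrightarrow> X = R" by (rule bexE)
  then have R_emb: "partial_embedding \<phi> R" and R0: "R0 \<subseteq> R" by simp_all
  have max: "X = R" if "partial_embedding \<phi> X" "R \<subseteq> X" for X
    using R_max that R0 by simp
  interpret algebraic_partial_emb \<phi> R using R_emb by (rule algebraic_partial_embI)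
  \<comment> \<open>Maximality forces totality: the image of the minimal polynomial of
    \<open>x\<close> has a root, and \<open>x\<close> can be sent to it.\<close>
  have total: "\<exists>y. (x, y) \<in> R" for x
  proof -
    obtain m m' where m: "poly_rel R m m'" "lead_coeff m = 1" "degree m > 0" "poly m x = 0"
      "\<And>f f'. poly_rel R f f' \<Longrightarrow> poly f x = 0 \<Longrightarrow> \<exists>s s'. poly_rel R s s' \<and> f = m * s \<and> f' = m' * s'"
      using minimal_polynomial[of x] by metis
    obtain p where p: "separable_poly (map_poly \<phi> p)" "poly (map_poly \<phi> p) x = 0"
      using separable_closure_poly[of x] by metis
    \<comment> \<open>Having coefficients in F, \<open>p\<close> is related to itself. So not only
      \<open>m\<close> but also \<open>m'\<close> divides it, and \<open>m'\<close> inherits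
      separability.\<close>
    obtain s' where "map_poly \<phi> p = m' * s'" using m(5)[OF poly_rel_map_poly p(2)] by blast
    then have "separable_poly m'" using p(1) separable_poly_factor by metis
    moreover have "degree m' > 0"
    proof -
      have "(lead_coeff m, coeff m' (degree m)) \<in> R" using m(1) by (simp add: poly_rel_def)
      then have "coeff m' (degree m) = 1" using m(2) R_1 R_unique by metis
      then have "degree m \<le> degree m'" by (intro le_degree) simp
      then show ?thesis using m(3) by simp
    qed
    ultimately obtain y where "poly m' y = 0" using separable_closure_root by blast
    then obtain R' where "partial_embedding \<phi> R'" "R \<subseteq> R'" "(x, y) \<in> R'"
      using extend_partial_embedding[OF m(1,5)] by metis
    then show ?thesis using max by blast
  qed
  define \<gamma> where "\<gamma> x = (THE y. (x, y) \<in> R)" for x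
  have gR: "(x, y) \<in> R \<longleftrightarrow> \<gamma> x = y" for x y
    unfolding \<gamma>_def using total[of x] R_unique by (metis the_equality)
  have "field_embedding \<gamma>"
    unfolding field_embedding_def using R_1 R_add R_mult unfolding gR by metis
  moreover have fixed: "\<gamma> (\<phi> r) = \<phi> r" for r using R_base unfolding gR .
  moreover have "bij \<gamma>" using phi alg \<open>field_embedding \<gamma>\<close> fixed by (rule embedding_over_bij)
  ultimately show thesis using that[of \<gamma>] R0 gR unfolding galois_group_def by blast
qed

text \<open>Start from the identity of F as partial embedding. A root \<open>y\<close> of the
  cofactor of X - x in the minimal polynomial gives an automorphism sending \<open>x\<close> to
  \<open>y\<close>, so y = x; but a separable polynomial has no double root. Hence the cofactor is
  constant and the minimal polynomial linear, with coefficients in F.\<close>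

theorem galois_group_fixed_field:
  assumes fixed: "\<And>\<gamma>. \<gamma> \<in> galois_group \<phi> \<Longrightarrow> \<gamma> x = x"
  shows "x \<in> range \<phi>"
proof -
  note phi = separable_closure_embedding
  define D where "D = range (\<lambda>r. (\<phi> r, \<phi> r))"
  have "partial_embedding \<phi> D" unfolding partial_embedding_def D_def
    by (auto simp: field_embedding_add[OF phi, symmetric] field_embedding_mult[OF phi, symmetric])
  then interpret algebraic_partial_emb \<phi> D by (rule algebraic_partial_embI)
  obtain m m' where m: "poly_rel D m m'" "lead_coeff m = 1" "degree m > 0" "poly m x = 0"
    "\<And>f f'. poly_rel D f f' \<Longrightarrow> poly f x = 0 \<Longrightarrow> \<exists>s s'. poly_rel D s s' \<and> f = m * s \<and> f' = m' * s'"
    using minimal_polynomial[of x] by metis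
  have D_eq: "a = b" if "(a, b) \<in> D" for a b using that by (auto simp: D_def)
  have "m' = m" using m(1) D_eq unfolding poly_rel_def by (intro poly_eqI) metis
  obtain p where p: "separable_poly (map_poly \<phi> p)" "poly (map_poly \<phi> p) x = 0"
    using separable_closure_poly[of x] by metis
  have "separable_poly m"
    using m(5)[OF poly_rel_map_poly p(2)] p(1) separable_poly_factor by metis
  obtain h where h: "m = [:-x, 1:] * h" using m(4) by (metis dvdE poly_eq_0_iff_dvd)
  have "h \<noteq> 0" using m(3) h by auto
  have "separable_poly h" using \<open>separable_poly m\<close> h separable_poly_factor mult.commute by metis
  have "degree h = 0"
  proof (rule ccontr)
    assume "degree h \<noteq> 0"
    then obtain y where y: "poly h y = 0" using separable_closure_root \<open>separable_poly h\<close> by blast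
    then have "poly m' y = 0" using h \<open>m' = m\<close> by simp
    then obtain R' where R': "partial_embedding \<phi> R'" "(x, y) \<in> R'"
      using extend_partial_embedding[OF m(1,5)] by metis
    obtain \<gamma> where "\<gamma> \<in> galois_group \<phi>" "\<gamma> x = y" using partial_embedding_extends[OF R'(1)] R'(2) by metis
    then have "y = x" using fixed by metis
    then show False using y \<open>separable_poly m\<close> h separable_poly_no_double_root by metis
  qed
  then obtain c where "h = [:c:]" using degree_eq_zeroE by blast
  then have "m = [:-x * c, c:]" "c \<noteq> 0" using h \<open>h \<noteq> 0\<close> by auto
  then have "m = [:-x, 1:]" using m(2) by simp
  then have "coeff m 0 = - x" by simp
  moreover have "(coeff m 0, coeff m' 0) \<in> D" using m(1) by (simp add: poly_rel_def)
  ultimately obtain r where "- x = \<phi> r" unfolding D_def by auto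
  then show ?thesis using field_embedding_minus[OF phi, of r] by (metis minus_minus rangeI)
qed

end

section \<open>Scalar extension\<close>

lemma tensor_eval_superset:
  assumes "finite S" "Poly_Mapping.keys z \<subseteq> S"
  shows "tensor_eval tn z = (\<Sum>p\<in>S. of_int (Poly_Mapping.lookup z p) * tn (fst p) (snd p))"
  unfolding tensor_eval_def using assms
  by (intro sum.mono_neutral_left) (auto simp: in_keys_iff)

lemma additive_tensor_eval: "Modules.additive (tensor_eval tn)"
proof
  fix y z :: "'a \<times> 'b \<Rightarrow>\<^sub>0 int"
  let ?S = "Poly_Mapping.keys y \<union> Poly_Mapping.keys z"
  have "Poly_Mapping.keys (y + z) \<subseteq> ?S" by (rule Poly_Mapping.keys_add)
  then show "tensor_eval tn (y + z) = tensor_eval tn y + tensor_eval tn z"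
    using tensor_eval_superset[of ?S _ tn]
    by (simp add: lookup_add distrib_right sum.distrib)
qed

lemmas tensor_eval_add = additive.add[OF additive_tensor_eval]
  and tensor_eval_diff = additive.diff[OF additive_tensor_eval]
  and tensor_eval_0 = additive.zero[OF additive_tensor_eval]
  and tensor_eval_sum = additive.sum[OF additive_tensor_eval]

lemma tensor_eval_frag_of: "tensor_eval tn (frag_of p) = tn (fst p) (snd p)"
  by (simp add: tensor_eval_def)

lemma keys_subset_diff:
  "Poly_Mapping.keys a \<subseteq> S \<Longrightarrow> Poly_Mapping.keys b \<subseteq> S \<Longrightarrow> Poly_Mapping.keys (a - b) \<subseteq> S"
  using keys_diff[of a b] by blast

text \<open>The maps that factor additively through the tensor product. Only additive behaviour is
  recorded, so that coordinate functions qualify as well as algebra homomorphisms.\<close>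

definition balanced ::
  "('f::field \<Rightarrow> 'k::field) \<Rightarrow> ('f \<Rightarrow> 'a::ring_1 \<Rightarrow> 'a) \<Rightarrow> 'a set \<Rightarrow> ('a \<Rightarrow> 'k \<Rightarrow> 'm::ring_1) \<Rightarrow> bool" where
  "balanced \<phi> sc L f \<longleftrightarrow>
     (\<forall>a\<in>L. \<forall>b\<in>L. \<forall>c. f (a + b) c = f a c + f b c) \<and>
     (\<forall>a\<in>L. \<forall>c d. f a (c + d) = f a c + f a d) \<and>
     (\<forall>a\<in>L. \<forall>r c. f (sc r a) c = f a (\<phi> r * c))"

lemma balanced_iff_tensor_relations:
  "balanced \<phi> sc L f \<longleftrightarrow> (\<forall>z\<in>tensor_relations \<phi> sc L. tensor_eval f z = 0)"
  (is "?l \<longleftrightarrow> ?r")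
proof
  assume ?l
  then show ?r
    by (auto simp: balanced_def tensor_relations_def tensor_eval_diff tensor_eval_frag_of)
next
  assume r: ?r
  have "f (a + b) c = f a c + f b c" if "a \<in> L" "b \<in> L" for a b c
  proof -
    have "frag_of (a + b, c) - frag_of (a, c) - frag_of (b, c) \<in> tensor_relations \<phi> sc L"
      using that unfolding tensor_relations_def by blast
    then have "tensor_eval f (frag_of (a + b, c) - frag_of (a, c) - frag_of (b, c)) = 0" using r by blast
    then show ?thesis by (simp add: tensor_eval_diff tensor_eval_frag_of diff_eq_eq add.commute)
  qed
  moreover have "f a (c + d) = f a c + f a d" if "a \<in> L" for a c d
  proof -
    have "frag_of (a, c + d) - frag_of (a, c) - frag_of (a, d) \<in> tensor_relations \<phi> sc L"
      using that unfolding tensor_relations_def by blast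
    then have "tensor_eval f (frag_of (a, c + d) - frag_of (a, c) - frag_of (a, d)) = 0" using r by blast
    then show ?thesis by (simp add: tensor_eval_diff tensor_eval_frag_of diff_eq_eq add.commute)
  qed
  moreover have "f (sc r a) c = f a (\<phi> r * c)" if "a \<in> L" for a r c
  proof -
    have "frag_of (sc r a, c) - frag_of (a, \<phi> r * c) \<in> tensor_relations \<phi> sc L"
      using that unfolding tensor_relations_def by blast
    then have "tensor_eval f (frag_of (sc r a, c) - frag_of (a, \<phi> r * c)) = 0" using r by blast
    then show ?thesis by (simp add: tensor_eval_diff tensor_eval_frag_of)
  qed
  ultimately show ?l unfolding balanced_def by blast
qed

lemma balanced_group_closure:
  assumes "balanced \<phi> sc L f" "z \<in> group_closure (tensor_relations \<phi> sc L)"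
  shows "tensor_eval f z = 0"
  using assms(2)
proof induction
  case (base s)
  then show ?case
    using assms(1) by (auto simp: balanced_iff_tensor_relations tensor_eval_0)
qed (simp add: tensor_eval_diff)

lemma
  assumes "is_tensor_algebra \<phi> sc L tn"
  shows tensor_algebra_surj: "\<exists>z. Poly_Mapping.keys z \<subseteq> L \<times> UNIV \<and> tensor_eval tn z = x"
    and tensor_algebra_kernel: "Poly_Mapping.keys z \<subseteq> L \<times> UNIV \<Longrightarrow> tensor_eval tn z = 0 \<Longrightarrow>
      z \<in> group_closure (tensor_relations \<phi> sc L)"
    and tensor_algebra_balanced: "balanced \<phi> sc L tn"
    and tensor_algebra_1: "tn 1 1 = 1"
    and tensor_algebra_mult: "a \<in> L \<Longrightarrow> b \<in> L \<Longrightarrow> tn a c * tn b d = tn (a * b) (c * d)"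
proof -
  have ker: "{z. Poly_Mapping.keys z \<subseteq> L \<times> UNIV \<and> tensor_eval tn z = 0} = group_closure (tensor_relations \<phi> sc L)"
    using assms unfolding is_tensor_algebra_def by blast
  show "\<exists>z. Poly_Mapping.keys z \<subseteq> L \<times> UNIV \<and> tensor_eval tn z = x"
    using assms unfolding is_tensor_algebra_def by (metis (mono_tags, lifting) UNIV_I imageE mem_Collect_eq)
  show "z \<in> group_closure (tensor_relations \<phi> sc L)"
    if "Poly_Mapping.keys z \<subseteq> L \<times> UNIV" "tensor_eval tn z = 0"
    using that ker by blast
  have "z \<in> group_closure (tensor_relations \<phi> sc L)" if "z \<in> tensor_relations \<phi> sc L" for z
    using that by (intro group_closure.base) simp
  then show "balanced \<phi> sc L tn" unfolding balanced_iff_tensor_relations using ker by blast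
  show "tn 1 1 = 1" "a \<in> L \<Longrightarrow> b \<in> L \<Longrightarrow> tn a c * tn b d = tn (a * b) (c * d)"
    using assms unfolding is_tensor_algebra_def by blast+
qed

text \<open>\<open>g\<close> evaluates \<open>f\<close> on a chosen preimage in the free group. Two
  preimages differ by an element of the group generated by the relations, on which \<open>f\<close>
  evaluates to 0.\<close>

lemma tensor_algebra_universal:
  fixes f :: "'a::ring_1 \<Rightarrow> 'k::field \<Rightarrow> 'm::ring_1"
  assumes T: "is_tensor_algebra \<phi> sc L tn" and f: "balanced \<phi> sc L f"
  obtains g where "Modules.additive g" "\<And>a c. a \<in> L \<Longrightarrow> g (tn a c) = f a c"
proof -
  define rp where "rp x = (SOME z. Poly_Mapping.keys z \<subseteq> L \<times> UNIV \<and> tensor_eval tn z = x)" for x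
  have rp: "Poly_Mapping.keys (rp x) \<subseteq> L \<times> UNIV" "tensor_eval tn (rp x) = x" for x
    using someI_ex[OF tensor_algebra_surj[OF T, of x]] unfolding rp_def by blast+
  define g where "g x = tensor_eval f (rp x)" for x
  have g_eval: "g (tensor_eval tn z) = tensor_eval f z" if "Poly_Mapping.keys z \<subseteq> L \<times> UNIV" for z
  proof -
    have "rp (tensor_eval tn z) - z \<in> group_closure (tensor_relations \<phi> sc L)"
      by (intro tensor_algebra_kernel[OF T] keys_subset_diff rp that) (simp add: tensor_eval_diff rp)
    then have "tensor_eval f (rp (tensor_eval tn z) - z) = 0" by (rule balanced_group_closure[OF f])
    then show ?thesis by (simp add: tensor_eval_diff g_def)
  qed
  show thesis
  proof
    show "Modules.additive g"
    proof
      fix x y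
      have "Poly_Mapping.keys (rp x + rp y) \<subseteq> L \<times> UNIV"
        using Poly_Mapping.keys_add[of "rp x" "rp y"] rp(1) by blast
      then have "g (tensor_eval tn (rp x + rp y)) = tensor_eval f (rp x + rp y)" by (rule g_eval)
      then show "g (x + y) = g x + g y" by (simp add: tensor_eval_add rp g_def)
    qed
    show "g (tn a c) = f a c" if "a \<in> L" for a c
      using g_eval[of "frag_of (a, c)"] that by (simp add: tensor_eval_frag_of)
  qed
qed

lemma tensor_algebra_induct:
  assumes T: "is_tensor_algebra \<phi> sc L tn"
    and "P 0" "\<And>a c. a \<in> L \<Longrightarrow> P (tn a c)" "\<And>x y. P x \<Longrightarrow> P y \<Longrightarrow> P (x - y)"
  shows "P x"
proof -
  obtain z where z: "Poly_Mapping.keys z \<subseteq> L \<times> UNIV" "tensor_eval tn z = x"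
    using tensor_algebra_surj[OF T] by metis
  have "P (tensor_eval tn z)"
    using z(1) by (induction rule: frag_induction)
      (auto simp: tensor_eval_0 tensor_eval_frag_of tensor_eval_diff assms)
  then show ?thesis using z(2) by simp
qed

section \<open>The scalar extension of A and its two systems of coordinates\<close>

locale base_change =
  fixes \<phi> :: "'f::field \<Rightarrow> 'k::field" and sc :: "'f \<Rightarrow> 'a::ring_1 \<Rightarrow> 'a"
    and tn :: "'a \<Rightarrow> 'k \<Rightarrow> 't::ring_1"
  assumes phi: "field_embedding \<phi>" and algebra: "algebra_over sc"
    and tensor: "is_tensor_algebra \<phi> sc UNIV tn"
begin

lemma tn_add_left: "tn (a + b) c = tn a c + tn b c"
  and tn_add_right: "tn a (c + d) = tn a c + tn a d"
  and tn_scale_left: "tn (sc r a) c = tn a (\<phi> r * c)"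
  using tensor_algebra_balanced[OF tensor] by (auto simp: balanced_def)

lemma tn_mult: "tn a c * tn b d = tn (a * b) (c * d)"
  using tensor_algebra_mult[OF tensor] by simp

lemmas tn_1 = tensor_algebra_1[OF tensor]

lemma tensor_induct [case_names zero tensor diff]:
  assumes "P 0" "\<And>a c. P (tn a c)" "\<And>x y. P x \<Longrightarrow> P y \<Longrightarrow> P (x - y)"
  shows "P x"
  using assms by (rule tensor_algebra_induct[OF tensor])

lemma additive_tn_left: "Modules.additive (\<lambda>a. tn a c)"
  and additive_tn_right: "Modules.additive (tn a)"
  by unfold_locales (simp_all add: tn_add_left tn_add_right)

lemmas tn_0_left = additive.zero[OF additive_tn_left]
  and tn_0_right = additive.zero[OF additive_tn_right]
  and tn_diff_left = additive.diff[OF additive_tn_left]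
  and tn_sum_left = additive.sum[OF additive_tn_left]
  and tn_sum_right = additive.sum[OF additive_tn_right]
  and tn_diff_right = additive.diff[OF additive_tn_right]

lemma scalar_central: "tn 1 c * x = x * tn 1 c"
  by (induction x rule: tensor_induct) (auto simp: tn_mult algebra_simps)

sublocale A: vector_space sc
  using algebra by (simp add: algebra_over_def)

sublocale T: vector_space "ext_scale tn"
  by unfold_locales (auto simp: ext_scale_def algebra_simps tn_add_right tn_1 tn_mult mult.assoc[symmetric])

sublocale K: vector_space "\<lambda>r c. \<phi> r * c"
  by unfold_locales
    (auto simp: algebra_simps field_embedding_add[OF phi] field_embedding_mult[OF phi] field_embedding_1[OF phi])

lemma ext_scale_mult_left: "ext_scale tn c x * y = ext_scale tn c (x * y)"
  and ext_scale_mult_right: "x * ext_scale tn c y = ext_scale tn c (x * y)"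
  unfolding ext_scale_def by (metis mult.assoc scalar_central)+

lemma ext_scale_tn: "ext_scale tn c (tn a d) = tn a (c * d)"
  by (simp add: ext_scale_def tn_mult)

lemma algebra_over_restr_scale: "algebra_over (restr_scale \<phi> tn)"
  unfolding algebra_over_def vector_space_def restr_scale_def
  by (auto simp: ext_scale_mult_left ext_scale_mult_right T.scale_right_distrib T.scale_left_distrib
      field_embedding_add[OF phi] field_embedding_mult[OF phi] field_embedding_1[OF phi])

lemma restr_scale_tn_1: "restr_scale \<phi> tn r (tn a 1) = tn (sc r a) 1"
  by (simp add: restr_scale_def ext_scale_tn tn_scale_left)

text \<open>Coordinates in \<open>A\<close> with respect to a basis of \<open>K\<close> over \<open>F\<close>, and in \<open>K\<close> with respect to a basis of
  \<open>A\<close> over \<open>F\<close>: the former are bimodule maps, the latter are compatible with the Galois action.\<close>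

definition left_coord :: "'k \<Rightarrow> 't \<Rightarrow> 'a" where
  "left_coord c = (SOME g. Modules.additive g \<and>
     (\<forall>a d. g (tn a d) = sc (K.representation (K.extend_basis {}) d c) a))"

lemma K_basis: "K.independent (K.extend_basis {})" "K.span (K.extend_basis {}) = UNIV"
  using K.independent_extend_basis[OF K.independent_empty] K.span_extend_basis[OF K.independent_empty]
  by simp_all

lemma left_coord_aux:
  "Modules.additive (left_coord c) \<and>
   (\<forall>a d. left_coord c (tn a d) = sc (K.representation (K.extend_basis {}) d c) a)"
  (is "?P (left_coord c)")
proof -
  have "K.representation (K.extend_basis {}) (d + e) c =
      K.representation (K.extend_basis {}) d c + K.representation (K.extend_basis {}) e c" for d e
    using K.representation_add[OF K_basis(1)] K_basis(2) by simp
  moreover have "K.representation (K.extend_basis {}) (\<phi> r * d) c = r * K.representation (K.extend_basis {}) d c"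
    for r d
    using K.representation_scale[OF K_basis(1)] K_basis(2) by simp
  moreover have "sc (r * s) a = sc s (sc r a)" for r s a by (simp add: mult.commute)
  ultimately have "balanced \<phi> sc UNIV (\<lambda>a d. sc (K.representation (K.extend_basis {}) d c) a)"
    unfolding balanced_def
    by (simp add: A.scale_right_distrib A.scale_left_distrib del: A.scale_scale)
  then obtain g where "Modules.additive g"
    "\<And>a d. g (tn a d) = sc (K.representation (K.extend_basis {}) d c) a"
    using tensor_algebra_universal[OF tensor] by (metis UNIV_I)
  then have "?P g" by simp
  then show ?thesis unfolding left_coord_def by (rule someI[of ?P])
qed

lemma left_coord_tn: "left_coord c (tn a d) = sc (K.representation (K.extend_basis {}) d c) a"
  using left_coord_aux by blast

lemma additive_left_coord: "Modules.additive (left_coord c)"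
  using left_coord_aux by blast

lemmas left_coord_0 = additive.zero[OF additive_left_coord]
  and left_coord_add = additive.add[OF additive_left_coord]
  and left_coord_diff = additive.diff[OF additive_left_coord]

lemma left_coord_mult_left: "left_coord c (tn a 1 * x) = a * left_coord c x"
  and left_coord_mult_right: "left_coord c (x * tn a 1) = left_coord c x * a"
proof -
  have sc: "sc r x * y = sc r (x * y)" "x * sc r y = sc r (x * y)" for r x y
    using algebra by (auto simp: algebra_over_def)
  show "left_coord c (tn a 1 * x) = a * left_coord c x"
    by (induction x rule: tensor_induct)
      (auto simp: left_coord_0 left_coord_diff right_diff_distrib tn_mult left_coord_tn sc)
  show "left_coord c (x * tn a 1) = left_coord c x * a"
    by (induction x rule: tensor_induct)
      (auto simp: left_coord_0 left_coord_diff left_diff_distrib tn_mult left_coord_tn sc)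
qed

text \<open>The basis of K over F may be infinite, so a finite set containing the support has to be
  produced along the induction.\<close>

lemma left_coord_expansion_aux:
  "\<exists>S. finite S \<and> (\<forall>c. c \<notin> S \<longrightarrow> left_coord c x = 0) \<and> x = (\<Sum>c\<in>S. tn (left_coord c x) c)"
proof (induction x rule: tensor_induct)
  case zero
  show ?case by (rule exI[of _ "{}"]) (simp add: left_coord_0)
next
  case (tensor a d)
  let ?r = "K.representation (K.extend_basis {}) d"
  have "d = (\<Sum>c | ?r c \<noteq> 0. \<phi> (?r c) * c)"
    using K.sum_nonzero_representation_eq[of "K.extend_basis {}" d] K_basis by simp
  then have "tn a d = (\<Sum>c | ?r c \<noteq> 0. tn a (\<phi> (?r c) * c))"
    using tn_sum_right by metis
  also have "\<dots> = (\<Sum>c | ?r c \<noteq> 0. tn (left_coord c (tn a d)) c)"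
    by (simp add: left_coord_tn tn_scale_left)
  finally have "tn a d = (\<Sum>c | ?r c \<noteq> 0. tn (left_coord c (tn a d)) c)" .
  moreover have "\<forall>c. c \<notin> {c. ?r c \<noteq> 0} \<longrightarrow> left_coord c (tn a d) = 0" by (simp add: left_coord_tn)
  ultimately show ?case using K.finite_representation by blast
next
  case (diff x y)
  obtain S where S: "finite S" "\<And>c. c \<notin> S \<Longrightarrow> left_coord c x = 0" "x = (\<Sum>c\<in>S. tn (left_coord c x) c)"
    using diff by blast
  obtain S' where S': "finite S'" "\<And>c. c \<notin> S' \<Longrightarrow> left_coord c y = 0" "y = (\<Sum>c\<in>S'. tn (left_coord c y) c)"
    using diff by blast
  have "(\<Sum>c\<in>S \<union> S'. tn (left_coord c x) c) = (\<Sum>c\<in>S. tn (left_coord c x) c)"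
    using S S' by (intro sum.mono_neutral_right) (auto simp: tn_0_left)
  moreover have "(\<Sum>c\<in>S \<union> S'. tn (left_coord c y) c) = (\<Sum>c\<in>S'. tn (left_coord c y) c)"
    using S S' by (intro sum.mono_neutral_right) (auto simp: tn_0_left)
  ultimately have "(\<Sum>c\<in>S \<union> S'. tn (left_coord c x) c) - (\<Sum>c\<in>S \<union> S'. tn (left_coord c y) c) = x - y"
    using S(3) S'(3) by simp
  then have "x - y = (\<Sum>c\<in>S \<union> S'. tn (left_coord c (x - y)) c)"
    by (simp add: left_coord_diff tn_diff_left sum_subtractf)
  moreover have "\<forall>c. c \<notin> S \<union> S' \<longrightarrow> left_coord c (x - y) = 0"
    using S(2) S'(2) by (simp add: left_coord_diff)
  ultimately show ?case using S(1) S'(1) by blast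
qed

lemma finite_left_coord: "finite {c. left_coord c x \<noteq> 0}"
proof -
  obtain S where "finite S" "\<forall>c. c \<notin> S \<longrightarrow> left_coord c x = 0"
    using left_coord_expansion_aux by blast
  then show ?thesis by (auto intro: finite_subset[of _ S])
qed

lemma left_coord_expansion: "x = (\<Sum>c | left_coord c x \<noteq> 0. tn (left_coord c x) c)"
proof -
  obtain S where S: "finite S" "\<forall>c. c \<notin> S \<longrightarrow> left_coord c x = 0" "x = (\<Sum>c\<in>S. tn (left_coord c x) c)"
    using left_coord_expansion_aux by blast
  have "(\<Sum>c | left_coord c x \<noteq> 0. tn (left_coord c x) c) = (\<Sum>c\<in>S. tn (left_coord c x) c)"
    using S(1,2) by (intro sum.mono_neutral_left) (auto simp: tn_0_left)
  then show ?thesis using S(3) by simp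
qed

lemma left_coord_eq_0: "(\<And>c. left_coord c x = 0) \<Longrightarrow> x = 0"
  using left_coord_expansion[of x] by simp

definition coord :: "'a set \<Rightarrow> 'a \<Rightarrow> 't \<Rightarrow> 'k" where
  "coord B b = (SOME g. Modules.additive g \<and> (\<forall>a d. g (tn a d) = \<phi> (A.representation B a b) * d))"

context
  fixes B
  assumes B: "A.independent B" "A.span B = UNIV" "finite B"
begin

lemma coord_aux:
  "Modules.additive (coord B b) \<and> (\<forall>a d. coord B b (tn a d) = \<phi> (A.representation B a b) * d)"
  (is "?P (coord B b)")
proof -
  have "balanced \<phi> sc UNIV (\<lambda>a d. \<phi> (A.representation B a b) * d)"
    unfolding balanced_def
    by (auto simp: A.representation_add A.representation_scale B algebra_simps
        field_embedding_add[OF phi] field_embedding_mult[OF phi])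
  then obtain g where "Modules.additive g" "\<And>a d. g (tn a d) = \<phi> (A.representation B a b) * d"
    using tensor_algebra_universal[OF tensor] by (metis UNIV_I)
  then have "?P g" by simp
  then show ?thesis unfolding coord_def by (rule someI[of ?P])
qed

lemma coord_tn: "coord B b (tn a d) = \<phi> (A.representation B a b) * d"
  and additive_coord: "Modules.additive (coord B b)"
  using coord_aux by blast+

lemmas coord_0 = additive.zero[OF additive_coord]
  and coord_diff = additive.diff[OF additive_coord]
  and coord_sum = additive.sum[OF additive_coord]

lemma coord_basis: "b' \<in> B \<Longrightarrow> coord B b (tn b' d) = (if b = b' then d else 0)"
  by (simp add: coord_tn A.representation_basis B field_embedding_0[OF phi] field_embedding_1[OF phi])

lemma coord_scale: "coord B b (ext_scale tn c x) = c * coord B b x"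
  unfolding ext_scale_def
  by (induction x rule: tensor_induct)
    (auto simp: coord_0 coord_tn tn_mult coord_diff right_diff_distrib)

lemma coord_expansion: "x = (\<Sum>b\<in>B. tn b (coord B b x))"
proof (induction x rule: tensor_induct)
  case zero
  show ?case by (simp add: coord_0 tn_0_right)
next
  case (tensor a d)
  have "a = (\<Sum>b\<in>B. sc (A.representation B a b) b)"
    using A.sum_representation_eq[of B a B] B by simp
  then have "(\<Sum>b\<in>B. tn (sc (A.representation B a b) b) d) = tn a d" using tn_sum_left by metis
  then show ?case by (simp add: coord_tn tn_scale_left)
next
  case (diff x y)
  then have "(\<Sum>b\<in>B. tn b (coord B b x)) - (\<Sum>b\<in>B. tn b (coord B b y)) = x - y" by simp
  then show ?case by (simp add: coord_diff tn_diff_right sum_subtractf)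
qed

lemma coord_eq_0: "(\<And>b. b \<in> B \<Longrightarrow> coord B b x = 0) \<Longrightarrow> x = 0"
  using coord_expansion[of x] by (simp add: tn_0_right)

lemma inj_on_tn_basis: "inj_on (\<lambda>b. tn b 1) B"
proof (rule inj_onI)
  fix b b' assume bb: "b \<in> B" "b' \<in> B" "tn b 1 = tn b' 1"
  have "coord B b (tn b 1) = 1" "coord B b (tn b' 1) = (if b = b' then 1 else 0)"
    using bb(1,2) by (simp_all add: coord_basis)
  then show "b = b'" using bb(3) by (auto split: if_splits)
qed

lemma independent_tn_basis: "T.independent ((\<lambda>b. tn b 1) ` B)"
proof (rule T.independent_if_scalars_zero)
  show "finite ((\<lambda>b. tn b 1) ` B)" using B by simp
  fix f x assume f: "(\<Sum>x\<in>(\<lambda>b. tn b 1) ` B. ext_scale tn (f x) x) = 0" and x: "x \<in> (\<lambda>b. tn b 1) ` B"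
  obtain b where b: "b \<in> B" "x = tn b 1" using x by blast
  have "(\<Sum>b\<in>B. tn b (f (tn b 1))) = 0"
    using f by (simp add: sum.reindex[OF inj_on_tn_basis] ext_scale_tn)
  then have "coord B b (\<Sum>b\<in>B. tn b (f (tn b 1))) = 0" by (simp add: coord_0)
  then show "f x = 0" using b B(3) by (simp add: coord_sum coord_basis)
qed

lemma span_tn_basis: "T.span ((\<lambda>b. tn b 1) ` B) = UNIV"
proof -
  have "x \<in> T.span ((\<lambda>b. tn b 1) ` B)" for x
  proof -
    have "(\<Sum>b\<in>B. ext_scale tn (coord B b x) (tn b 1)) \<in> T.span ((\<lambda>b. tn b 1) ` B)"
      by (intro T.span_sum T.span_scale T.span_base) auto
    then show ?thesis using coord_expansion[of x] by (simp add: ext_scale_tn)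
  qed
  then show ?thesis by blast
qed

lemma finite_dimensional_tensor: "finite_dimensional_vector_space (ext_scale tn) ((\<lambda>b. tn b 1) ` B)"
  by unfold_locales (use B independent_tn_basis span_tn_basis in auto)

lemma dim_tensor: "T.dim UNIV = card B"
  using T.basis_card_eq_dim[OF _ _ independent_tn_basis, of UNIV] span_tn_basis card_image[OF inj_on_tn_basis]
  by simp

end

end

section \<open>Scalar extension preserves central simplicity\<close>

context base_change
begin

text \<open>A nonzero element of \<open>J\<close> of minimal support can be normalized to have a coordinate \<open>1\<close>; its
  commutators with \<open>A\<close> have smaller support and vanish, so its coordinates are central.\<close>

lemma base_change_simple:
  fixes J :: "'t set"
  assumes csa: "central_simple_algebra sc" and J: "two_sided_ideal J" and x: "x \<in> J" "x \<noteq> 0"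
  shows "1 \<in> J"
proof -
  define supp where "supp y = {c. left_coord c y \<noteq> 0}" for y
  have fin_supp: "finite (supp y)" for y unfolding supp_def by (rule finite_left_coord)
  have J_add: "a \<in> J \<Longrightarrow> b \<in> J \<Longrightarrow> a + b \<in> J" and J_right: "a \<in> J \<Longrightarrow> a * b \<in> J"
    and J_left: "a \<in> J \<Longrightarrow> b * a \<in> J" and J_0: "0 \<in> J" for a b
    using J unfolding two_sided_ideal_def right_ideal_def by blast+
  have J_diff: "a - b \<in> J" if "a \<in> J" "b \<in> J" for a b
    using J_add[OF that(1) J_right[OF that(2), of "- 1"]] by simp
  obtain y where y: "y \<in> J" "y \<noteq> 0"
    and min: "\<And>z. z \<in> J \<Longrightarrow> z \<noteq> 0 \<Longrightarrow> card (supp y) \<le> card (supp z)"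
    using arg_min_nat_lemma[of "\<lambda>z. z \<in> J \<and> z \<noteq> 0" x "\<lambda>z. card (supp z)"] x by auto
  obtain c0 where c0: "left_coord c0 y \<noteq> 0" using left_coord_eq_0 y(2) by blast
  \<comment> \<open>The coordinates at \<open>c0\<close> of the elements of \<open>J\<close>
    supported within \<open>supp y\<close> form a two-sided ideal of A. It contains a nonzero
    element, hence 1; this is the normalization.\<close>
  define A0 where "A0 = {left_coord c0 z | z. z \<in> J \<and> supp z \<subseteq> supp y}"
  have "two_sided_ideal A0"
    unfolding two_sided_ideal_def right_ideal_def
  proof (intro conjI ballI allI)
    show "0 \<in> A0" unfolding A0_def using J_0 by (force simp: supp_def left_coord_0)
    fix a assume "a \<in> A0"
    then obtain z where z: "a = left_coord c0 z" "z \<in> J" "supp z \<subseteq> supp y" unfolding A0_def by blast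
    then have z0: "left_coord c y = 0 \<Longrightarrow> left_coord c z = 0" for c by (auto simp: supp_def)
    show "a * b \<in> A0" for b
    proof -
      have "a * b = left_coord c0 (z * tn b 1)" using z by (simp add: left_coord_mult_right)
      moreover have "supp (z * tn b 1) \<subseteq> supp y" using z0 by (auto simp: supp_def left_coord_mult_right)
      ultimately show ?thesis unfolding A0_def using J_right[OF z(2)] by blast
    qed
    show "b * a \<in> A0" for b
    proof -
      have "b * a = left_coord c0 (tn b 1 * z)" using z by (simp add: left_coord_mult_left)
      moreover have "supp (tn b 1 * z) \<subseteq> supp y" using z0 by (auto simp: supp_def left_coord_mult_left)
      ultimately show ?thesis unfolding A0_def using J_left[OF z(2)] by blast
    qed
    fix b assume "b \<in> A0"
    then obtain w where w: "b = left_coord c0 w" "w \<in> J" "supp w \<subseteq> supp y" unfolding A0_def by blast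
    then have w0: "left_coord c y = 0 \<Longrightarrow> left_coord c w = 0" for c by (auto simp: supp_def)
    have "a + b = left_coord c0 (z + w)" using z w by (simp add: left_coord_add)
    moreover have "supp (z + w) \<subseteq> supp y" using z0 w0 by (auto simp: supp_def left_coord_add)
    ultimately show "a + b \<in> A0" unfolding A0_def using J_add[OF z(2) w(2)] by blast
  qed
  moreover have "left_coord c0 y \<in> A0" unfolding A0_def using y(1) by blast
  ultimately have "A0 = UNIV" using csa c0 unfolding central_simple_algebra_def by blast
  then have "1 \<in> A0" by simp
  then obtain z where z: "left_coord c0 z = 1" "z \<in> J" "supp z \<subseteq> supp y" unfolding A0_def by auto
  then have z0: "left_coord c y = 0 \<Longrightarrow> left_coord c z = 0" for c by (auto simp: supp_def)
  have comm: "tn a 1 * z = z * tn a 1" for a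
  proof (rule ccontr)
    define w where "w = tn a 1 * z - z * tn a 1"
    assume "tn a 1 * z \<noteq> z * tn a 1"
    then have "w \<noteq> 0" by (simp add: w_def)
    moreover have "w \<in> J" unfolding w_def by (intro J_diff J_left J_right z(2))
    ultimately have "card (supp y) \<le> card (supp w)" using min by blast
    moreover have wc: "left_coord c w = a * left_coord c z - left_coord c z * a" for c
      by (simp add: w_def left_coord_diff left_coord_mult_left left_coord_mult_right)
    have "supp w \<subset> supp y"
    proof
      show "supp w \<subseteq> supp y" using z0 by (auto simp: supp_def wc)
      show "supp w \<noteq> supp y" using z(1) c0 wc[of c0] unfolding supp_def by auto
    qed
    then have "card (supp w) < card (supp y)" using fin_supp by (intro psubset_card_mono)
    ultimately show False by simp
  qed
  have "\<exists>r. left_coord c z = sc r 1" for c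
  proof -
    have "left_coord c z * a = a * left_coord c z" for a
      using arg_cong[OF comm[of a], of "left_coord c"]
      by (simp add: left_coord_mult_left left_coord_mult_right)
    moreover have "{z. \<forall>x. z * x = x * z} = range (\<lambda>r. sc r 1)"
      using csa unfolding central_simple_algebra_def by blast
    ultimately show ?thesis by blast
  qed
  then obtain r where r: "\<And>c. left_coord c z = sc (r c) 1" by metis
  \<comment> \<open>With all coordinates in F, \<open>z\<close> collapses to a pure tensor
    \<open>tn 1 d\<close> with d nonzero, which is a unit.\<close>
  have "tn 1 (\<Sum>c\<in>supp z. \<phi> (r c) * c) = (\<Sum>c\<in>supp z. tn (left_coord c z) c)"
    by (simp add: tn_sum_right r tn_scale_left)
  then have "z = tn 1 (\<Sum>c\<in>supp z. \<phi> (r c) * c)"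
    using left_coord_expansion[of z] unfolding supp_def by simp
  then obtain d where d: "z = tn 1 d" by blast
  have "d \<noteq> 0" using z(1) d by (auto simp: tn_0_right left_coord_0)
  then have "z * tn 1 (inverse d) = 1" using d by (simp add: tn_mult tn_1)
  then show ?thesis using J_right[OF z(2)] by metis
qed

end

text \<open>A recognition criterion for \<open>is_tensor_algebra\<close>. Modulo the relations every
  formal sum reduces to one with a single term (m, c m) for each m in \<open>M\<close>, and on these
  normal forms evaluation is injective by \<open>indep\<close>; so nothing beyond the relations
  evaluates to 0.\<close>

lemma tensor_algebra_from_basis:
  fixes t :: "'a::ring_1 \<Rightarrow> 'k::field \<Rightarrow> 't::ring_1" and \<phi> :: "'f::field \<Rightarrow> 'k"
  assumes "algebra_over sc" and phi: "field_embedding \<phi>"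
    and M: "finite M" "M \<subseteq> L" and L: "module.subspace sc L"
    and span: "\<And>l. l \<in> L \<Longrightarrow> \<exists>r. l = (\<Sum>m\<in>M. sc (r m) m)"
    and bal: "balanced \<phi> sc L t"
    and one: "t 1 1 = 1"
    and mult: "\<And>a b c d. a \<in> L \<Longrightarrow> b \<in> L \<Longrightarrow> t a c * t b d = t (a * b) (c * d)"
    and indep: "\<And>c. (\<Sum>m\<in>M. t m (c m)) = 0 \<Longrightarrow> \<forall>m\<in>M. c m = 0"
    and surj: "\<And>x. \<exists>c. x = (\<Sum>m\<in>M. t m (c m))"
  shows "is_tensor_algebra \<phi> sc L t"
proof -
  interpret vector_space sc using assms(1) by (simp add: algebra_over_def)
  note L_0 = subspace_0[OF L] and L_add = subspace_add[OF L] and L_scale = subspace_scale[OF L]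
    and L_sum = subspace_sum[OF L]
  define G where "G = group_closure (tensor_relations \<phi> sc L)"
  have G_0: "0 \<in> G" and G_diff: "\<And>a b. a \<in> G \<Longrightarrow> b \<in> G \<Longrightarrow> a - b \<in> G"
    and G_add: "\<And>a b. a \<in> G \<Longrightarrow> b \<in> G \<Longrightarrow> a + b \<in> G"
    and G_base: "\<And>a. a \<in> tensor_relations \<phi> sc L \<Longrightarrow> a \<in> G"
    unfolding G_def by (auto intro: group_closure.intros group_closure_add)
  have rel_add: "frag_of (a + b, c) - frag_of (a, c) - frag_of (b, c) \<in> G" if "a \<in> L" "b \<in> L" for a b c
    using that by (intro G_base) (unfold tensor_relations_def, blast)
  have rel_add2: "frag_of (a, c + d) - frag_of (a, c) - frag_of (a, d) \<in> G" if "a \<in> L" for a c d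
    using that by (intro G_base) (unfold tensor_relations_def, blast)
  have rel_scale: "frag_of (sc r a, c) - frag_of (a, \<phi> r * c) \<in> G" if "a \<in> L" for a r c
    using that by (intro G_base) (unfold tensor_relations_def, blast)
  have rel_0: "frag_of (a, 0) \<in> G" if "a \<in> L" for a
    \<comment> \<open>For c = d = 0 the additivity relation is
      \<open>- frag_of (a, 0)\<close>.\<close>
    using G_diff[OF G_0 rel_add2[OF that, of 0 0]] by simp
  have rel_diff: "frag_of (a, c - d) - (frag_of (a, c) - frag_of (a, d)) \<in> G" if "a \<in> L" for a c d
    using G_diff[OF G_0 rel_add2[OF that, of "c - d" d]] by (simp add: algebra_simps)
  have G_sum: "(\<Sum>i\<in>S. f i) \<in> G" if "\<And>i. i \<in> S \<Longrightarrow> f i \<in> G" for S and f :: "_ \<Rightarrow> 'a \<times> 'k \<Rightarrow>\<^sub>0 int"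
    using that by (induction S rule: infinite_finite_induct) (auto intro: G_0 G_add)
  have rel_0_left: "frag_of (0, c) \<in> G" for c
    using G_diff[OF G_0 rel_add[OF L_0 L_0, of c]] by simp
  have rel_sum: "frag_of (\<Sum>m\<in>S. f m, c) - (\<Sum>m\<in>S. frag_of (f m, c)) \<in> G"
    if "finite S" "\<And>m. m \<in> S \<Longrightarrow> f m \<in> L" for S c and f :: "'a \<Rightarrow> 'a"
    using that
  proof (induction S rule: finite_induct)
    case (insert m S)
    have "frag_of (f m + sum f S, c) - frag_of (f m, c) - frag_of (sum f S, c) \<in> G"
      using insert by (intro rel_add L_sum) auto
    from G_add[OF this insert.IH] insert show ?case by (simp add: algebra_simps)
  qed (simp add: rel_0_left)
  have reduce: "\<exists>c. z - (\<Sum>m\<in>M. frag_of (m, c m)) \<in> G" if "Poly_Mapping.keys z \<subseteq> L \<times> UNIV" for z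
    using that
  proof (induction rule: frag_induction)
    case zero
    have "(\<Sum>m\<in>M. frag_of (m, 0)) \<in> G" using M by (intro G_sum rel_0) auto
    then have "0 - (\<Sum>m\<in>M. frag_of (m, 0)) \<in> G" by (intro G_diff G_0)
    then show ?case by (rule exI[of _ "\<lambda>_. 0"])
  next
    case (one p)
    obtain l c where p: "p = (l, c)" "l \<in> L" using one by (metis mem_Sigma_iff prod.collapse)
    obtain r where r: "l = (\<Sum>m\<in>M. sc (r m) m)" using span p(2) by blast
    have "frag_of (l, c) - (\<Sum>m\<in>M. frag_of (sc (r m) m, c)) \<in> G"
      unfolding r using M by (intro rel_sum L_scale) auto
    moreover have "(\<Sum>m\<in>M. frag_of (sc (r m) m, c) - frag_of (m, \<phi> (r m) * c)) \<in> G"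
      using M by (intro G_sum rel_scale) auto
    ultimately have "frag_of (l, c) - (\<Sum>m\<in>M. frag_of (sc (r m) m, c)) +
        (\<Sum>m\<in>M. frag_of (sc (r m) m, c) - frag_of (m, \<phi> (r m) * c)) \<in> G" by (rule G_add)
    then have "frag_of p - (\<Sum>m\<in>M. frag_of (m, \<phi> (r m) * c)) \<in> G"
      by (simp add: p sum_subtractf)
    then show ?case by (rule exI[of _ "\<lambda>m. \<phi> (r m) * c"])
  next
    case (diff a b)
    obtain c where c: "a - (\<Sum>m\<in>M. frag_of (m, c m)) \<in> G" using diff by blast
    obtain d where d: "b - (\<Sum>m\<in>M. frag_of (m, d m)) \<in> G" using diff by blast
    have "(\<Sum>m\<in>M. frag_of (m, c m - d m) - (frag_of (m, c m) - frag_of (m, d m))) \<in> G"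
      using M by (intro G_sum rel_diff) auto
    then have *: "(\<Sum>m\<in>M. frag_of (m, c m - d m)) -
        ((\<Sum>m\<in>M. frag_of (m, c m)) - (\<Sum>m\<in>M. frag_of (m, d m))) \<in> G"
      by (simp only: sum_subtractf)
    have "(a - C) - (b - D) - (E - (C - D)) = a - b - E" for C D E :: "'a \<times> 'k \<Rightarrow>\<^sub>0 int"
      by (simp add: algebra_simps)
    then have "a - b - (\<Sum>m\<in>M. frag_of (m, c m - d m)) \<in> G"
      using G_diff[OF G_diff[OF c d] *] by metis
    then show ?case by (rule exI[of _ "\<lambda>m. c m - d m"])
  qed
  have G_eval: "tensor_eval t z = 0" if "z \<in> G" for z
    using that unfolding G_def by (rule balanced_group_closure[OF bal])
  have eval_sum: "tensor_eval t (\<Sum>m\<in>M. frag_of (m, c m)) = (\<Sum>m\<in>M. t m (c m))" for c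
    by (simp add: tensor_eval_sum tensor_eval_frag_of)
  \<comment> \<open>The kernel consists of formal sums over \<open>L\<close> times K, so the
    generated group must be shown to stay among them; this uses that \<open>L\<close> is a
    subspace.\<close>
  have G_keys: "Poly_Mapping.keys z \<subseteq> L \<times> UNIV" if "z \<in> G" for z
    using that unfolding G_def
  proof induction
    case (base s)
    have k1: "Poly_Mapping.keys (frag_of p) \<subseteq> L \<times> UNIV" if "p \<in> L \<times> UNIV" for p :: "'a \<times> 'k"
      using that by simp
    show ?case
    proof (cases "s = 0")
      case False
      then have "s \<in> tensor_relations \<phi> sc L" using base by simp
      then show ?thesis unfolding tensor_relations_def
        by (elim UnE CollectE exE conjE; simp only:; intro keys_subset_diff k1)
          (auto intro: L_add L_scale)
    qed simp
  qed (rule keys_subset_diff)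
  show ?thesis unfolding is_tensor_algebra_def
  proof (intro conjI ballI allI)
    show "tensor_eval t ` {z. Poly_Mapping.keys z \<subseteq> L \<times> UNIV} = UNIV"
    proof (intro equalityI subsetI UNIV_I)
      fix x obtain c where c: "x = (\<Sum>m\<in>M. t m (c m))" using surj by blast
      have "Poly_Mapping.keys (\<Sum>m\<in>M. frag_of (m, c m)) \<subseteq> (\<Union>m\<in>M. Poly_Mapping.keys (frag_of (m, c m)))"
        by (rule Poly_Mapping.keys_sum)
      also have "\<dots> \<subseteq> L \<times> UNIV" using M(2) by auto
      finally show "x \<in> tensor_eval t ` {z. Poly_Mapping.keys z \<subseteq> L \<times> UNIV}"
        using c eval_sum[of c] by (intro image_eqI) auto
    qed
    have "z \<in> G" if kz: "Poly_Mapping.keys z \<subseteq> L \<times> UNIV" and ez: "tensor_eval t z = 0" for z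
    proof -
      obtain c where c: "z - (\<Sum>m\<in>M. frag_of (m, c m)) \<in> G" using reduce[OF kz] by blast
      then have "(\<Sum>m\<in>M. t m (c m)) = 0" using G_eval[OF c] ez by (simp add: tensor_eval_diff eval_sum)
      then have "\<forall>m\<in>M. c m = 0" by (rule indep)
      then have "(\<Sum>m\<in>M. frag_of (m, c m)) \<in> G" using M(2) by (intro G_sum) (auto intro: rel_0)
      from G_add[OF c this] show ?thesis by simp
    qed
    then show "{z. Poly_Mapping.keys z \<subseteq> L \<times> UNIV \<and> tensor_eval t z = 0} =
        group_closure (tensor_relations \<phi> sc L)"
      using G_eval G_keys unfolding G_def[symmetric] by blast
  qed (use one mult in auto)
qed

section \<open>The Galois action and descent\<close>

locale galois_base_change = base_change +
  assumes sep: "separable_closure \<phi>" and finite_dim: "\<exists>B. finite B \<and> A.span B = UNIV"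
begin

text \<open>Two bases of A will be used: \<open>B\<close>, from the empty set, for the Galois
  action, and one extending a basis of the fixed algebra, for linear disjointness.\<close>

lemma extend_basis_finite:
  assumes "A.independent M"
  shows "A.independent (A.extend_basis M)" "A.span (A.extend_basis M) = UNIV" "finite (A.extend_basis M)"
proof -
  show *: "A.independent (A.extend_basis M)" and "A.span (A.extend_basis M) = UNIV"
    using assms by (simp_all add: A.independent_extend_basis)
  obtain B0 where "finite B0" "A.span B0 = UNIV" using finite_dim by blast
  then show "finite (A.extend_basis M)" using A.independent_span_bound[of B0, OF _ *] by simp
qed

abbreviation "B \<equiv> A.extend_basis {}"

lemmas B_basis = extend_basis_finite[OF A.independent_empty]

text \<open>Existence comes from the universal property. As \<open>galois_act\<close> is a definite
  description, uniqueness is needed too: additive maps that agree on pure tensors are equal.\<close>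

lemma galois_act_aux:
  assumes "\<gamma> \<in> galois_group \<phi>"
  shows "(\<forall>x y. galois_act tn \<gamma> (x + y) = galois_act tn \<gamma> x + galois_act tn \<gamma> y) \<and>
    (\<forall>a c. galois_act tn \<gamma> (tn a c) = tn a (\<gamma> c))" (is "?P (galois_act tn \<gamma>)")
proof -
  have g: "field_embedding \<gamma>" "\<And>r. \<gamma> (\<phi> r) = \<phi> r" using assms by (auto simp: galois_group_def)
  have "balanced \<phi> sc UNIV (\<lambda>a c. tn a (\<gamma> c))"
    unfolding balanced_def
    by (simp add: tn_add_left tn_add_right tn_scale_left field_embedding_add[OF g(1)] field_embedding_mult[OF g(1)] g(2))
  then obtain h where h: "Modules.additive h" "\<And>a c. h (tn a c) = tn a (\<gamma> c)"
    using tensor_algebra_universal[OF tensor] by (metis UNIV_I)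
  have "?P h" using additive.add[OF h(1)] h(2) by blast
  moreover have "h' = h" if "?P h'" for h'
  proof
    have h': "Modules.additive h'" using that by (simp add: Modules.additive_def)
    show "h' x = h x" for x
      by (induction x rule: tensor_induct)
        (use h that in \<open>simp_all add: additive.zero[OF h'] additive.zero[OF h(1)] additive.diff[OF h'] additive.diff[OF h(1)]\<close>)
  qed
  ultimately show ?thesis unfolding galois_act_def by (rule theI[of ?P])
qed

lemma act_add: "\<gamma> \<in> galois_group \<phi> \<Longrightarrow> galois_act tn \<gamma> (x + y) = galois_act tn \<gamma> x + galois_act tn \<gamma> y"
  and act_tn: "\<gamma> \<in> galois_group \<phi> \<Longrightarrow> galois_act tn \<gamma> (tn a c) = tn a (\<gamma> c)"
  using galois_act_aux by blast+

lemma additive_act: "\<gamma> \<in> galois_group \<phi> \<Longrightarrow> Modules.additive (galois_act tn \<gamma>)"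
  by (simp add: Modules.additive_def act_add)

lemmas act_0 = additive.zero[OF additive_act] and act_diff = additive.diff[OF additive_act]

lemma act_mult:
  assumes "\<gamma> \<in> galois_group \<phi>"
  shows "galois_act tn \<gamma> (x * y) = galois_act tn \<gamma> x * galois_act tn \<gamma> y"
proof (induction x rule: tensor_induct)
  case (tensor a c)
  have g: "field_embedding \<gamma>" using assms by (auto simp: galois_group_def)
  show ?case
    by (induction y rule: tensor_induct)
      (simp_all add: act_0[OF assms] act_tn[OF assms] tn_mult field_embedding_mult[OF g] act_diff[OF assms]
        right_diff_distrib)
qed (simp_all add: act_0[OF assms] act_diff[OF assms] left_diff_distrib)

lemma act_1: "\<gamma> \<in> galois_group \<phi> \<Longrightarrow> galois_act tn \<gamma> 1 = 1"
  using act_tn[of \<gamma> 1 1] by (auto simp: tn_1 galois_group_def field_embedding_1)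

lemma act_scale:
  "\<gamma> \<in> galois_group \<phi> \<Longrightarrow> galois_act tn \<gamma> (ext_scale tn c x) = ext_scale tn (\<gamma> c) (galois_act tn \<gamma> x)"
  by (simp add: ext_scale_def act_mult act_tn)

lemma galois_group_inv:
  assumes "\<gamma> \<in> galois_group \<phi>"
  shows "inv \<gamma> \<in> galois_group \<phi>" "\<gamma> (inv \<gamma> c) = c" "inv \<gamma> (\<gamma> c) = c"
proof -
  have g: "field_embedding \<gamma>" "bij \<gamma>" "\<And>r. \<gamma> (\<phi> r) = \<phi> r" using assms by (auto simp: galois_group_def)
  show 1: "\<gamma> (inv \<gamma> c) = c" and 2: "inv \<gamma> (\<gamma> c) = c" for c
    using g(2) by (simp_all add: bij_is_surj surj_f_inv_f bij_is_inj inv_f_f)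
  have "inv \<gamma> 1 = 1" using 2[of 1] field_embedding_1[OF g(1)] by simp
  moreover have "inv \<gamma> (x + y) = inv \<gamma> x + inv \<gamma> y" for x y
    using 2[of "inv \<gamma> x + inv \<gamma> y"] by (simp add: field_embedding_add[OF g(1)] 1)
  moreover have "inv \<gamma> (x * y) = inv \<gamma> x * inv \<gamma> y" for x y
    using 2[of "inv \<gamma> x * inv \<gamma> y"] by (simp add: field_embedding_mult[OF g(1)] 1)
  moreover have "inv \<gamma> (\<phi> r) = \<phi> r" for r using 2[of "\<phi> r"] g(3) by simp
  ultimately show "inv \<gamma> \<in> galois_group \<phi>"
    using bij_imp_bij_inv[OF g(2)] by (simp add: galois_group_def field_embedding_def)
qed

lemma act_inv:
  assumes "\<gamma> \<in> galois_group \<phi>"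
  shows "galois_act tn (inv \<gamma>) (galois_act tn \<gamma> x) = x" "galois_act tn \<gamma> (galois_act tn (inv \<gamma>) x) = x"
  by (induction x rule: tensor_induct)
    (simp_all add: act_0 act_diff act_tn galois_group_inv assms)

lemma coord_act:
  assumes "\<gamma> \<in> galois_group \<phi>"
  shows "coord B b (galois_act tn \<gamma> x) = \<gamma> (coord B b x)"
proof -
  have g: "field_embedding \<gamma>" "\<And>r. \<gamma> (\<phi> r) = \<phi> r" using assms by (auto simp: galois_group_def)
  show ?thesis
    by (induction x rule: tensor_induct)
      (simp_all add: act_0[OF assms] act_diff[OF assms] act_tn[OF assms] coord_0[OF B_basis] coord_diff[OF B_basis]
        coord_tn[OF B_basis] field_embedding_0[OF g(1)] field_embedding_diff[OF g(1)] field_embedding_mult[OF g(1)] g(2))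
qed

text \<open>The group acts on coordinates with respect to an F-basis of A, so a fixed element has
  fixed coordinates, and these lie in F.\<close>

lemma fixed_in_algebra:
  assumes "\<And>\<gamma>. \<gamma> \<in> galois_group \<phi> \<Longrightarrow> galois_act tn \<gamma> x = x"
  shows "x \<in> range (\<lambda>a. tn a 1)"
proof -
  have "\<exists>r. coord B b x = \<phi> r" for b
  proof -
    have "\<gamma> (coord B b x) = coord B b x" if "\<gamma> \<in> galois_group \<phi>" for \<gamma>
      using coord_act[OF that, of b x] assms[OF that] by simp
    then have "coord B b x \<in> range \<phi>" by (rule galois_group_fixed_field[OF sep])
    then show ?thesis by blast
  qed
  then obtain r where r: "\<And>b. coord B b x = \<phi> (r b)" by metis
  have "x = (\<Sum>b\<in>B. tn b (coord B b x))" by (rule coord_expansion[OF B_basis])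
  also have "\<dots> = tn (\<Sum>b\<in>B. sc (r b) b) 1" by (simp add: tn_sum_left tn_scale_left r)
  finally show ?thesis by blast
qed

lemma inj_tn_1: "inj (\<lambda>a. tn a 1)"
proof (rule injI)
  fix a b assume "tn a 1 = tn b 1"
  then have "coord B c (tn (a - b) 1) = 0" for c by (simp add: tn_diff_left coord_0[OF B_basis])
  then have "A.representation B (a - b) c = 0" for c
    by (simp add: coord_tn[OF B_basis] field_embedding_eq_0_iff[OF phi])
  then have "a - b = 0" using A.sum_representation_eq[of B "a - b" B] B_basis by simp
  then show "a = b" by simp
qed

text \<open>A vector of minimal support with a coordinate \<open>1\<close> is fixed, because \<open>\<gamma> u - u\<close> has smaller support.\<close>

lemma galois_descent:
  assumes W: "T.subspace W"
    and stable: "\<And>\<gamma> w. \<gamma> \<in> galois_group \<phi> \<Longrightarrow> w \<in> W \<Longrightarrow> galois_act tn \<gamma> w \<in> W"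
  shows "W \<subseteq> T.span (galois_fixed \<phi> tn W)"
proof -
  define supp where "supp y = {b\<in>B. coord B b y \<noteq> 0}" for y
  have fin_supp: "finite (supp y)" for y unfolding supp_def using B_basis(3) by simp
  note coord_simps = coord_diff[OF B_basis] coord_scale[OF B_basis]
  have "w \<in> T.span (galois_fixed \<phi> tn W)" if "w \<in> W" for w
    using that
  proof (induction "card (supp w)" arbitrary: w rule: less_induct)
    case less
    show ?case
    proof (cases "w = 0")
      case True
      then show ?thesis by (simp add: T.span_zero)
    next
      case False
      \<comment> \<open>Minimality is taken among vectors supported within \<open>supp w\<close>:
        subtracting a multiple of the normalized \<open>v\<close> then clears a coordinate of
        \<open>w\<close> without creating new ones, so the induction applies to the
        difference.\<close>
      obtain v where v: "v \<in> W" "v \<noteq> 0" "supp v \<subseteq> supp w"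
        and min: "\<And>z. z \<in> W \<Longrightarrow> z \<noteq> 0 \<Longrightarrow> supp z \<subseteq> supp w \<Longrightarrow> card (supp v) \<le> card (supp z)"
        using arg_min_nat_lemma[of "\<lambda>z. z \<in> W \<and> z \<noteq> 0 \<and> supp z \<subseteq> supp w" w "\<lambda>z. card (supp z)"]
          False less.prems by auto
      obtain b where b: "b \<in> B" "coord B b v \<noteq> 0" using coord_eq_0[OF B_basis] v(2) by blast
      define u where "u = ext_scale tn (inverse (coord B b v)) v"
      have u: "u \<in> W" "coord B b u = 1" "supp u = supp v"
        using b v(1) by (auto simp: u_def supp_def coord_simps intro: T.subspace_scale[OF W])
      have "galois_act tn \<gamma> u = u" if g: "\<gamma> \<in> galois_group \<phi>" for \<gamma>
      proof (rule ccontr)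
        have g': "field_embedding \<gamma>" using g by (auto simp: galois_group_def)
        define d where "d = galois_act tn \<gamma> u - u"
        assume "galois_act tn \<gamma> u \<noteq> u"
        then have "d \<noteq> 0" by (simp add: d_def)
        have dc: "coord B c d = \<gamma> (coord B c u) - coord B c u" for c
          by (simp add: d_def coord_simps coord_act[OF g])
        have "supp d \<subseteq> supp v" unfolding u(3)[symmetric]
          by (auto simp: supp_def dc field_embedding_0[OF g'])
        moreover have "b \<notin> supp d" using u(2) by (simp add: supp_def dc field_embedding_1[OF g'])
        moreover have "b \<in> supp v" using b by (simp add: supp_def)
        ultimately have "card (supp d) < card (supp v)" using fin_supp by (intro psubset_card_mono) auto
        moreover have "d \<in> W" unfolding d_def by (intro T.subspace_diff[OF W] stable g u(1))
        ultimately show False using min[of d] \<open>d \<noteq> 0\<close> \<open>supp d \<subseteq> supp v\<close> v(3) by fastforce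
      qed
      then have uF: "u \<in> galois_fixed \<phi> tn W" using u(1) by (simp add: galois_fixed_def)
      define w' where "w' = w - ext_scale tn (coord B b w) u"
      have "w' \<in> W" unfolding w'_def by (intro T.subspace_diff[OF W] T.subspace_scale[OF W] less.prems u(1))
      have wc: "coord B c w' = coord B c w - coord B b w * coord B c u" for c
        by (simp add: w'_def coord_simps)
      have "supp w' \<subseteq> supp w" using u(3) v(3) by (auto simp: supp_def wc)
      moreover have "b \<notin> supp w'" using u(2) by (simp add: supp_def wc)
      moreover have "b \<in> supp w" using b v(3) by (auto simp: supp_def)
      ultimately have "card (supp w') < card (supp w)" using fin_supp by (intro psubset_card_mono) auto
      then have "w' \<in> T.span (galois_fixed \<phi> tn W)" using less.hyps \<open>w' \<in> W\<close> by blast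
      then have "w' + ext_scale tn (coord B b w) u \<in> T.span (galois_fixed \<phi> tn W)"
        using T.span_scale[OF T.span_base[OF uF]] by (rule T.span_add)
      then show ?thesis by (simp add: w'_def)
    qed
  qed
  then show ?thesis by blast
qed

end

section \<open>Frames of minimal right ideals\<close>

locale projective_frame = galois_base_change \<phi> sc tn
  for \<phi> :: "'f::field \<Rightarrow> 'k::field" and sc :: "'f \<Rightarrow> 'a::ring_1 \<Rightarrow> 'a" and tn :: "'a \<Rightarrow> 'k \<Rightarrow> 't::ring_1" +
  fixes I :: "'n::finite \<Rightarrow> 't set"
  assumes csa: "central_simple_algebra sc"
    and dim_A: "A.dim UNIV = CARD('n)\<^sup>2"
    and right_ideal_I: "\<And>i. right_ideal (I i)"
    and dim_I: "\<And>i. T.dim (I i) = CARD('n)"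
    and sum_I: "{\<Sum>i\<in>UNIV. x i | x. \<forall>i. x i \<in> I i} = UNIV"
    and stable_I: "\<And>\<gamma>. \<gamma> \<in> galois_group \<phi> \<Longrightarrow> (\<lambda>J. galois_act tn \<gamma> ` J) ` range I \<subseteq> range I"
begin

section \<open>Linear algebra of the ideals: directness of the sum and endomorphisms\<close>

lemma I_0: "0 \<in> I i" and I_add: "x \<in> I i \<Longrightarrow> y \<in> I i \<Longrightarrow> x + y \<in> I i"
  and I_right: "x \<in> I i \<Longrightarrow> x * z \<in> I i"
  using right_ideal_I[of i] unfolding right_ideal_def by blast+

lemma I_scale: "x \<in> I i \<Longrightarrow> ext_scale tn c x \<in> I i"
  unfolding ext_scale_def scalar_central by (rule I_right)

lemma subspace_I: "T.subspace (I i)"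
  by (intro T.subspaceI I_0 I_add I_scale)

lemma dim_T: "T.dim UNIV = CARD('n \<times> 'n)"
proof -
  have "A.dim UNIV = card B" using A.basis_card_eq_dim[of B UNIV] B_basis by simp
  then show ?thesis using dim_tensor[OF B_basis] dim_A by (simp add: power2_eq_square)
qed

text \<open>The type \<open>'n\<close> labels the ideals and, each having dimension n, also a basis
  of each. Hence K^(\<open>'n\<close> x \<open>'n\<close>), of dimension n^2, can be compared with
  \<open>A_s\<close> in the two dimension counts that follow.\<close>

lemma ideal_coordinates:
  "\<exists>(v :: 'n \<Rightarrow> 't) (r :: 't \<Rightarrow> 'n \<Rightarrow> 'k).
    (\<forall>j. v j \<in> I i) \<and> (\<forall>x\<in>I i. x = (\<Sum>j\<in>UNIV. ext_scale tn (r x j) (v j))) \<and>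
    (\<forall>x\<in>I i. \<forall>y\<in>I i. \<forall>j. r (x + y) j = r x j + r y j) \<and>
    (\<forall>c. \<forall>x\<in>I i. \<forall>j. r (ext_scale tn c x) j = c * r x j)"
proof -
  obtain V where V: "V \<subseteq> I i" "T.independent V" "I i \<subseteq> T.span V" "card V = CARD('n)"
    using T.basis_exists[of "I i"] dim_I by metis
  have "finite V" using V(4) by (metis card.infinite zero_less_card_finite less_irrefl)
  then obtain v :: "'n \<Rightarrow> 't" where v: "bij_betw v UNIV V"
    using finite_same_card_bij[of "UNIV :: 'n set" V] V(4) by auto
  have span_V: "T.span V = I i" using V(1,3) subspace_I T.span_minimal by blast
  define r where "r x j = T.representation V x (v j)" for x j
  have "x = (\<Sum>j\<in>UNIV. ext_scale tn (r x j) (v j))" if "x \<in> I i" for x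
  proof -
    have "(\<Sum>b\<in>V. ext_scale tn (T.representation V x b) b) = x"
      using T.sum_representation_eq[of V x V] V \<open>finite V\<close> that by auto
    moreover have "(\<Sum>j\<in>UNIV. ext_scale tn (r x j) (v j)) = (\<Sum>b\<in>V. ext_scale tn (T.representation V x b) b)"
      unfolding r_def by (rule sum.reindex_bij_betw[OF v])
    ultimately show ?thesis by (simp only:)
  qed
  moreover have "v j \<in> I i" for j using v V(1) by (auto simp: bij_betw_def)
  ultimately show ?thesis
    by (intro exI[of _ v] exI[of _ r])
      (auto simp: r_def T.representation_add T.representation_scale V(2) span_V)
qed

text \<open>The first order serves to pass from onto to injective in \<open>I_direct\<close>, the
  second from injective to onto in \<open>I_endomorphism_scalar\<close>.\<close>

lemma finite_dimensional_pair:
  "finite_dimensional_vector_space_pair ((*s) :: 'k \<Rightarrow> 'k ^ ('n \<times> 'n) \<Rightarrow> _) cart_basis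
     (ext_scale tn) ((\<lambda>b. tn b 1) ` B)"
  "finite_dimensional_vector_space_pair (ext_scale tn) ((\<lambda>b. tn b 1) ` B)
     ((*s) :: 'k \<Rightarrow> 'k ^ ('n \<times> 'n) \<Rightarrow> _) cart_basis"
  using finite_dimensional_tensor[OF B_basis] vec.finite_dimensional_vector_space_axioms
  by (simp_all add: finite_dimensional_vector_space_pair_def)

text \<open>The bases of the n ideals together define a linear map from K^(n x n) to
  \<open>A_s\<close>, onto because the ideals sum to everything. Equality of dimensions makes it
  injective, which is directness of the sum.\<close>

lemma I_direct:
  assumes y: "\<And>i. y i \<in> I i" and "(\<Sum>i\<in>UNIV. y i) = 0"
  shows "y i = 0"
proof -
  obtain v :: "'n \<Rightarrow> 'n \<Rightarrow> 't" and r :: "'n \<Rightarrow> 't \<Rightarrow> 'n \<Rightarrow> 'k"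
    where r: "\<And>i x. x \<in> I i \<Longrightarrow> x = (\<Sum>j\<in>UNIV. ext_scale tn (r i x j) (v i j))"
    using ideal_coordinates by metis
  define f :: "'k ^ ('n \<times> 'n) \<Rightarrow> 't"
    where "f c = (\<Sum>i\<in>UNIV. \<Sum>j\<in>UNIV. ext_scale tn (c $ (i, j)) (v i j))" for c
  have f_sum: "f (\<chi> p. r (fst p) (z (fst p)) (snd p)) = (\<Sum>i\<in>UNIV. z i)" if "\<And>i. z i \<in> I i" for z
    unfolding f_def by (simp add: r[OF that, symmetric])
  have "Vector_Spaces.linear (*s) (ext_scale tn) f"
    unfolding Vector_Spaces.linear_iff f_def
    by (simp add: vec.vector_space_axioms T.vector_space_axioms T.scale_left_distrib sum.distrib
        T.scale_sum_right)
  moreover have "surj f"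
  proof -
    have "\<exists>c. x = f c" for x
    proof -
      have "x \<in> {\<Sum>i\<in>UNIV. x i | x. \<forall>i. x i \<in> I i}" using sum_I by simp
      then obtain z where "x = (\<Sum>i\<in>UNIV. z i)" "\<And>i. z i \<in> I i" by blast
      then show ?thesis using f_sum[of z] by metis
    qed
    then show ?thesis unfolding surj_def by blast
  qed
  moreover have "T.dim UNIV = vec.dim (UNIV :: ('k ^ ('n \<times> 'n)) set)"
    unfolding dim_T by (simp add: vec.dim_UNIV card_cart_basis)
  ultimately have "inj f"
    by (rule finite_dimensional_vector_space_pair.linear_surjective_imp_injective[OF finite_dimensional_pair(1)])
  have "f (\<chi> p. r (fst p) (y (fst p)) (snd p)) = f 0"
    using f_sum[OF y] assms(2) by (simp add: f_def)
  then have "(\<chi> p. r (fst p) (y (fst p)) (snd p)) = 0" using \<open>inj f\<close> by (simp add: inj_eq)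
  then have "r i (y i) j = 0" for j by (auto simp: vec_eq_iff)
  then show ?thesis using r[OF y[of i], symmetric] by simp
qed

lemma I_nonzero: "\<exists>x\<in>I i. x \<noteq> 0"
proof (rule ccontr)
  assume "\<not> ?thesis"
  then have "I i \<subseteq> T.span {}" by auto
  then have "T.dim (I i) \<le> card ({} :: 't set)" by (rule T.dim_le_card) simp
  then show False using dim_I[of i] by simp
qed

text \<open>The right annihilator of a right ideal is a two-sided ideal. It does not contain 1
  because the ideal is nonzero, so simplicity makes it zero.\<close>

lemma annihilator_I:
  assumes "\<And>y. y \<in> I i \<Longrightarrow> y * x = 0"
  shows "x = 0"
proof (rule ccontr)
  assume "x \<noteq> 0"
  define J where "J = {x. \<forall>y\<in>I i. y * x = 0}"
  have "two_sided_ideal J" unfolding two_sided_ideal_def right_ideal_def J_def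
    by (auto simp: distrib_left mult.assoc[symmetric] I_right)
  moreover have "x \<in> J" using assms by (simp add: J_def)
  ultimately have "1 \<in> J" using base_change_simple[OF csa] \<open>x \<noteq> 0\<close> by blast
  then show False using I_nonzero[of i] by (auto simp: J_def)
qed

text \<open>Right multiplication identifies \<open>A\<^sub>s\<close> with all linear endomorphisms of the ideal, because both
  spaces have dimension \<open>n\<^sup>2\<close>; left multiplications preserving the ideal commute with these.\<close>

lemma I_endomorphism_scalar:
  assumes x: "\<And>y. y \<in> I i \<Longrightarrow> x * y \<in> I i"
  shows "\<exists>s. \<forall>y\<in>I i. x * y = ext_scale tn s y"
proof -
  obtain v :: "'n \<Rightarrow> 't" and r :: "'t \<Rightarrow> 'n \<Rightarrow> 'k"
    where vr: "\<forall>j. v j \<in> I i" "\<forall>x\<in>I i. x = (\<Sum>j\<in>UNIV. ext_scale tn (r x j) (v j))"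
      "\<forall>x\<in>I i. \<forall>y\<in>I i. \<forall>j. r (x + y) j = r x j + r y j"
      "\<forall>c. \<forall>x\<in>I i. \<forall>j. r (ext_scale tn c x) j = c * r x j"
    using ideal_coordinates[of i] by (elim exE conjE) (rule that)
  note v = vr(1)[rule_format] and r = vr(2)[rule_format] and r_add = vr(3)[rule_format]
    and r_scale = vr(4)[rule_format]
  \<comment> \<open>\<open>f t\<close> is the matrix of right multiplication by \<open>t\<close> in
    the basis \<open>v\<close>.\<close>
  define f :: "'t \<Rightarrow> 'k ^ ('n \<times> 'n)" where "f t = (\<chi> p. r (v (fst p) * t) (snd p))" for t
  have vt: "v j * t \<in> I i" for j t by (intro I_right v)
  have f_linear: "Vector_Spaces.linear (ext_scale tn) (*s) f"
    unfolding Vector_Spaces.linear_iff f_def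
    by (simp add: vec.vector_space_axioms T.vector_space_axioms vec_eq_iff distrib_left r_add vt
        ext_scale_mult_right r_scale)
  have "inj f"
  proof -
    have "t = 0" if "f t = 0" for t
    proof (rule annihilator_I)
      fix y assume y: "y \<in> I i"
      have "r (v j * t) k = 0" for j k
        using that unfolding f_def by (auto simp: vec_eq_iff)
      then have vt0: "v j * t = 0" for j using r[OF vt[of j t], symmetric] by simp
      have "y * t = (\<Sum>j\<in>UNIV. ext_scale tn (r y j) (v j)) * t" by (simp add: r[OF y, symmetric])
      also have "\<dots> = 0" by (simp add: sum_distrib_right ext_scale_mult_left vt0)
      finally show "y * t = 0" .
    qed
    moreover have "f (x - y) = f x - f y" for x y
      by (rule module_hom.diff[OF f_linear[unfolded module_hom_iff_linear[symmetric]]])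
    ultimately show ?thesis by (metis injI right_minus_eq)
  qed
  have "vec.dim (UNIV :: ('k ^ ('n \<times> 'n)) set) = T.dim UNIV"
    unfolding dim_T by (simp add: vec.dim_UNIV card_cart_basis)
  with f_linear \<open>inj f\<close> have "surj f"
    by (rule finite_dimensional_vector_space_pair.linear_injective_imp_surjective[OF finite_dimensional_pair(2)])
  define j0 :: 'n where "j0 = undefined"
  have scal: "x * v k = ext_scale tn (r (x * v j0) j0) (v k)" for k
  proof -
    \<comment> \<open>Right multiplication by \<open>t\<close> is a matrix unit: it sends
      \<open>v j0\<close> to \<open>v k\<close> and the other basis vectors to 0. Thus x * v k = (x
      * v j0) * t retains only the \<open>j0\<close> coordinate of x * v j0, a scalar that does not
      depend on \<open>k\<close>.\<close>
    obtain t where t: "f t = (\<chi> p. if p = (j0, k) then 1 else 0)" using \<open>surj f\<close> by (metis surjD)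
    have rt: "r (v j * t) m = (if j = j0 \<and> m = k then 1 else 0)" for j m
      using arg_cong[OF t, of "\<lambda>c. c $ (j, m)"] by (simp add: f_def)
    have vt': "v j * t = (if j = j0 then v k else 0)" for j
    proof -
      have "v j * t = (\<Sum>m\<in>UNIV. ext_scale tn (r (v j * t) m) (v m))" by (rule r[OF vt])
      also have "\<dots> = (\<Sum>m\<in>UNIV. if m = k then (if j = j0 then v k else 0) else 0)"
        by (rule sum.cong) (auto simp: rt)
      finally show ?thesis by simp
    qed
    have "x * v k = (x * v j0) * t" using vt'[of j0] by (simp add: mult.assoc)
    also have "\<dots> = (\<Sum>m\<in>UNIV. ext_scale tn (r (x * v j0) m) (v m)) * t"
      by (simp add: r[OF x[OF v[of j0]], symmetric])
    also have "\<dots> = (\<Sum>m\<in>UNIV. if m = j0 then ext_scale tn (r (x * v j0) j0) (v k) else 0)"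
      unfolding sum_distrib_right by (rule sum.cong) (auto simp: ext_scale_mult_left vt')
    finally show ?thesis by simp
  qed
  then obtain s where s: "\<And>k. x * v k = ext_scale tn s (v k)" by blast
  have "x * y = ext_scale tn s y" if y: "y \<in> I i" for y
  proof -
    have "x * (\<Sum>j\<in>UNIV. ext_scale tn (r y j) (v j)) =
        ext_scale tn s (\<Sum>j\<in>UNIV. ext_scale tn (r y j) (v j))"
      by (simp add: sum_distrib_left ext_scale_mult_right s T.scale_sum_right mult.commute)
    then show ?thesis by (simp only: r[OF y, symmetric])
  qed
  then show ?thesis by blast
qed

section \<open>Orthogonal idempotents and the split algebra \<open>Ls\<close>\<close>

definition e :: "'n \<Rightarrow> 't" where
  "e = (SOME e. (\<forall>i. e i \<in> I i) \<and> (\<Sum>i\<in>UNIV. e i) = 1)"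

lemma e_in_I: "e i \<in> I i" and sum_e: "(\<Sum>i\<in>UNIV. e i) = 1"
proof -
  have "1 \<in> {\<Sum>i\<in>UNIV. x i | x. \<forall>i. x i \<in> I i}" using sum_I by simp
  then have "\<exists>e. (\<forall>i. e i \<in> I i) \<and> (\<Sum>i\<in>UNIV. e i) = 1" by force
  from someI_ex[OF this] show "e i \<in> I i" "(\<Sum>i\<in>UNIV. e i) = 1" by (simp_all add: e_def)
qed

text \<open>Multiplying 1 = sum of the \<open>e j\<close> by \<open>y\<close> writes
  \<open>y\<close> as a sum of elements e j * y of \<open>I j\<close>. As the sum of the ideals is
  direct and \<open>y\<close> lies in \<open>I i\<close>, only the term for \<open>i\<close>
  survives.\<close>

lemma e_mult:
  assumes "y \<in> I i"
  shows "e j * y = (if j = i then y else 0)"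
proof -
  define z where "z j = e j * y - (if j = i then y else 0)" for j
  have "z j \<in> I j" for j
    unfolding z_def by (intro T.subspace_diff[OF subspace_I] I_right e_in_I) (auto simp: I_0 assms)
  moreover have "(\<Sum>j\<in>UNIV. z j) = 0"
    by (simp add: z_def sum_subtractf sum_distrib_right[symmetric] sum_e)
  ultimately have "z j = 0" by (rule I_direct)
  then show ?thesis by (simp add: z_def)
qed

lemma e_nonzero: "e i \<noteq> 0"
proof
  assume "e i = 0"
  then have "x = 0" if "x \<in> I i" for x using e_mult[OF that, of i] by (metis mult_zero_left)
  then show False using I_nonzero[of i] by blast
qed

lemma I_inj:
  assumes "I i = I j"
  shows "i = j"
proof (rule ccontr)
  assume "i \<noteq> j"
  then have "e j * e i = 0" using e_mult[OF e_in_I, of j i] by simp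
  moreover have "e i \<in> I j" using e_in_I[of i] assms by simp
  then have "e j * e i = e i" using e_mult[of "e i" j j] by simp
  ultimately show False using e_nonzero[of i] by simp
qed

definition Ls :: "'t set" where "Ls = {x. \<forall>i. \<forall>y\<in>I i. x * y \<in> I i}"

text \<open>The eigenvalue of left multiplication by \<open>x\<close> on \<open>I i\<close>; it is
  meaningful for \<open>x\<close> in \<open>Ls\<close>, where \<open>I_endomorphism_scalar\<close>
  provides it.\<close>

definition \<xi> :: "'n \<Rightarrow> 't \<Rightarrow> 'k" where
  "\<xi> i x = (SOME s. \<forall>y\<in>I i. x * y = ext_scale tn s y)"

lemma xi: "x \<in> Ls \<Longrightarrow> y \<in> I i \<Longrightarrow> x * y = ext_scale tn (\<xi> i x) y"
  using someI_ex[OF I_endomorphism_scalar[of i x]] unfolding \<xi>_def Ls_def by blast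

text \<open>An element of \<open>Ls\<close> is scalar on all of \<open>I i\<close>, so the single
  nonzero vector \<open>e i\<close> detects the scalar. The algebraic laws of the eigenvalues reduce
  to this test.\<close>

lemma xi_unique: "x \<in> Ls \<Longrightarrow> x * e i = ext_scale tn s (e i) \<Longrightarrow> \<xi> i x = s"
  using xi[of x "e i" i] e_in_I e_nonzero by auto

lemma e_in_Ls: "e i \<in> Ls"
  by (auto simp: Ls_def e_mult I_0)

lemma subspace_Ls: "T.subspace Ls"
  by (rule T.subspaceI) (auto simp: Ls_def distrib_right ext_scale_mult_left intro: I_0 I_add I_scale)

lemma Ls_mult: "x \<in> Ls \<Longrightarrow> y \<in> Ls \<Longrightarrow> x * y \<in> Ls" and Ls_1: "1 \<in> Ls"
  by (auto simp: Ls_def mult.assoc)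

lemma subalgebra_Ls: "subalgebra (ext_scale tn) Ls"
  using subspace_Ls Ls_mult Ls_1 by (simp add: subalgebra_def)

lemma xi_add: "x \<in> Ls \<Longrightarrow> y \<in> Ls \<Longrightarrow> \<xi> i (x + y) = \<xi> i x + \<xi> i y"
  by (rule xi_unique) (auto simp: T.subspace_add[OF subspace_Ls] distrib_right xi[OF _ e_in_I] T.scale_left_distrib)

lemma xi_scale: "x \<in> Ls \<Longrightarrow> \<xi> i (ext_scale tn c x) = c * \<xi> i x"
  by (rule xi_unique) (auto simp: T.subspace_scale[OF subspace_Ls] ext_scale_mult_left xi[OF _ e_in_I])

lemma xi_mult: "x \<in> Ls \<Longrightarrow> y \<in> Ls \<Longrightarrow> \<xi> i (x * y) = \<xi> i x * \<xi> i y"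
  by (rule xi_unique)
    (auto simp: Ls_mult mult.assoc ext_scale_mult_right xi[OF _ e_in_I] mult.commute[of "\<xi> i x"])

lemma xi_1: "\<xi> i 1 = 1"
  by (rule xi_unique) (auto simp: Ls_1)

lemma xi_0: "\<xi> i 0 = 0"
  using xi_scale[OF Ls_1, of i 0] by simp

lemma xi_sum: "(\<And>s. s \<in> S \<Longrightarrow> f s \<in> Ls) \<Longrightarrow> \<xi> i (\<Sum>s\<in>S. f s) = (\<Sum>s\<in>S. \<xi> i (f s))"
  by (induction S rule: infinite_finite_induct)
    (auto simp: xi_0 xi_add T.subspace_sum[OF subspace_Ls])

lemma xi_e: "\<xi> i (e j) = (if i = j then 1 else 0)"
  by (rule xi_unique) (auto simp: e_in_Ls e_mult[OF e_in_I])

lemma Ls_expansion: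
  assumes "x \<in> Ls"
  shows "x = (\<Sum>i\<in>UNIV. ext_scale tn (\<xi> i x) (e i))"
proof -
  have "x = x * (\<Sum>i\<in>UNIV. e i)" by (simp add: sum_e)
  also have "\<dots> = (\<Sum>i\<in>UNIV. ext_scale tn (\<xi> i x) (e i))"
    by (simp add: sum_distrib_left xi[OF assms e_in_I])
  finally show ?thesis .
qed

lemma Ls_eqI:
  assumes "x \<in> Ls" "y \<in> Ls" "\<And>i. \<xi> i x = \<xi> i y"
  shows "x = y"
proof -
  have "x = (\<Sum>i\<in>UNIV. ext_scale tn (\<xi> i y) (e i))" using Ls_expansion[OF assms(1)] by (simp only: assms(3))
  then show ?thesis using Ls_expansion[OF assms(2)] by (rule trans[OF _ sym])
qed

lemma Ls_commute: "x \<in> Ls \<Longrightarrow> y \<in> Ls \<Longrightarrow> x * y = y * x"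
  by (rule Ls_eqI) (auto simp: Ls_mult xi_mult)

lemma act_I:
  assumes "\<gamma> \<in> galois_group \<phi>"
  obtains j where "galois_act tn \<gamma> ` I i = I j"
proof -
  have "galois_act tn \<gamma> ` I i \<in> range I" using stable_I[OF assms] by blast
  then show thesis using that by blast
qed

text \<open>Move \<open>y\<close> back by the inverse automorphism: it lands in some
  \<open>I j\<close>, which \<open>x\<close> preserves, and moving forward again returns to
  \<open>I i\<close>.\<close>

lemma Ls_stable:
  assumes g: "\<gamma> \<in> galois_group \<phi>" and x: "x \<in> Ls"
  shows "galois_act tn \<gamma> x \<in> Ls"
  unfolding Ls_def
proof (intro CollectI allI ballI)
  fix i y assume y: "y \<in> I i"
  obtain j where j: "galois_act tn (inv \<gamma>) ` I i = I j"
    using act_I[OF galois_group_inv(1)[OF g]] by metis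
  then have "galois_act tn (inv \<gamma>) y \<in> I j" using y by blast
  then have "x * galois_act tn (inv \<gamma>) y \<in> I j" using x by (simp add: Ls_def)
  then obtain z where z: "z \<in> I i" "x * galois_act tn (inv \<gamma>) y = galois_act tn (inv \<gamma>) z"
    using j by blast
  have "galois_act tn \<gamma> x * y = galois_act tn \<gamma> (x * galois_act tn (inv \<gamma>) y)"
    by (simp add: act_mult[OF g] act_inv[OF g])
  also have "\<dots> = z" by (simp add: z act_inv[OF g])
  finally show "galois_act tn \<gamma> x * y \<in> I i" using z(1) by simp
qed

section \<open>The fixed algebra \<open>L\<close> is etale\<close>

definition L :: "'t set" where "L = galois_fixed \<phi> tn Ls"

lemma L_Ls: "l \<in> L \<Longrightarrow> l \<in> Ls" and L_fixed: "l \<in> L \<Longrightarrow> \<gamma> \<in> galois_group \<phi> \<Longrightarrow> galois_act tn \<gamma> l = l"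
  by (auto simp: L_def galois_fixed_def)

lemma L_I: "l \<in> Ls \<Longrightarrow> (\<And>\<gamma>. \<gamma> \<in> galois_group \<phi> \<Longrightarrow> galois_act tn \<gamma> l = l) \<Longrightarrow> l \<in> L"
  by (auto simp: L_def galois_fixed_def)

lemma L_tn:
  assumes "l \<in> L"
  obtains a where "l = tn a 1"
  using fixed_in_algebra[of l] L_fixed[OF assms] by blast

lemma restr_scale_eq: "restr_scale \<phi> tn r x = ext_scale tn (\<phi> r) x"
  by (simp add: restr_scale_def)

sublocale R: vector_space "restr_scale \<phi> tn"
  using algebra_over_restr_scale by (simp add: algebra_over_def)

lemma subalgebra_L: "subalgebra (restr_scale \<phi> tn) L"
  unfolding subalgebra_def
proof (intro conjI ballI)
  show "R.subspace L"
  proof (rule R.subspaceI)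
    show "0 \<in> L" by (rule L_I) (auto simp: T.subspace_0[OF subspace_Ls] act_0)
    show "x + y \<in> L" if "x \<in> L" "y \<in> L" for x y
      by (rule L_I) (use that in \<open>auto simp: T.subspace_add[OF subspace_Ls] L_Ls act_add L_fixed\<close>)
    show "restr_scale \<phi> tn c x \<in> L" if "x \<in> L" for c x
      by (rule L_I) (use that in \<open>auto simp: restr_scale_eq T.subspace_scale[OF subspace_Ls] L_Ls act_scale L_fixed galois_group_def\<close>)
  qed
  show "1 \<in> L" by (rule L_I) (auto simp: Ls_1 act_1)
  show "x * y \<in> L" if "x \<in> L" "y \<in> L" for x y
    by (rule L_I) (use that in \<open>auto simp: Ls_mult L_Ls act_mult L_fixed\<close>)
qed

lemma subspace_L: "R.subspace L" and L_1: "1 \<in> L" and L_mult: "x \<in> L \<Longrightarrow> y \<in> L \<Longrightarrow> x * y \<in> L"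
  using subalgebra_L by (auto simp: subalgebra_def)

text \<open>An F-basis of \<open>L\<close>, viewed inside A, extends to a basis of A, so it remains
  independent over K; descent shows that it spans \<open>Ls\<close> over K. The basis is kept in A
  rather than in \<open>L\<close> because \<open>coord\<close> refers to bases of A.\<close>

lemma basis_L:
  obtains M where "finite M" "\<And>m. m \<in> M \<Longrightarrow> tn m 1 \<in> L"
    "\<And>l. l \<in> L \<Longrightarrow> \<exists>r. l = (\<Sum>m\<in>M. tn (sc (r m) m) 1)"
    "\<And>c. (\<Sum>m\<in>M. tn m (c m)) = 0 \<Longrightarrow> \<forall>m\<in>M. c m = 0"
    "\<And>x. x \<in> Ls \<Longrightarrow> \<exists>c. x = (\<Sum>m\<in>M. tn m (c m))"
proof -
  obtain M where M: "M \<subseteq> {a. tn a 1 \<in> L}" "A.independent M" "{a. tn a 1 \<in> L} \<subseteq> A.span M"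
    using A.basis_exists by metis
  note basis = extend_basis_finite[OF M(2)]
  have sub: "M \<subseteq> A.extend_basis M" using M(2) by (rule A.extend_basis_superset)
  have fin: "finite M" using sub basis(3) by (rule finite_subset)
  have span: "\<exists>r. l = (\<Sum>m\<in>M. tn (sc (r m) m) 1)" if l: "l \<in> L" for l
  proof -
    obtain a where a: "l = tn a 1" using l by (rule L_tn)
    then have "a \<in> A.span M" using l M(3) by blast
    then obtain r where "a = (\<Sum>m\<in>M. sc (r m) m)" unfolding A.span_finite[OF fin] by blast
    then have "l = (\<Sum>m\<in>M. tn (sc (r m) m) 1)" by (simp add: a tn_sum_left)
    then show ?thesis by (rule exI[of _ r])
  qed
  have indep: "\<forall>m\<in>M. c m = 0" if c: "(\<Sum>m\<in>M. tn m (c m)) = 0" for c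
  proof
    fix m assume m: "m \<in> M"
    have "(\<Sum>m'\<in>M. coord (A.extend_basis M) m (tn m' (c m'))) = (\<Sum>m'\<in>M. if m' = m then c m' else 0)"
      using sub by (intro sum.cong) (auto simp: coord_basis[OF basis])
    also have "\<dots> = c m" using fin m by simp
    finally have "c m = coord (A.extend_basis M) m (\<Sum>m\<in>M. tn m (c m))"
      by (simp add: coord_sum[OF basis])
    then show "c m = 0" by (simp add: c coord_0[OF basis])
  qed
  define S where "S = range (\<lambda>c. \<Sum>m\<in>M. tn m (c m))"
  have "T.subspace S"
  proof (rule T.subspaceI)
    have "0 = (\<Sum>m\<in>M. tn m 0)" by (simp add: tn_0_right)
    then show "0 \<in> S" unfolding S_def by (rule range_eqI[of _ _ "\<lambda>m. 0"])
    fix x y assume "x \<in> S" "y \<in> S"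
    then obtain c d where cd: "x = (\<Sum>m\<in>M. tn m (c m))" "y = (\<Sum>m\<in>M. tn m (d m))"
      unfolding S_def by blast
    have "x + y = (\<Sum>m\<in>M. tn m (c m + d m))" by (simp add: cd tn_add_right sum.distrib)
    then show "x + y \<in> S" unfolding S_def by (rule range_eqI[of _ _ "\<lambda>m. c m + d m"])
  next
    fix a x assume "x \<in> S"
    then obtain c where c: "x = (\<Sum>m\<in>M. tn m (c m))" unfolding S_def by blast
    have "ext_scale tn a x = (\<Sum>m\<in>M. tn m (a * c m))" by (simp add: c T.scale_sum_right ext_scale_tn)
    then show "ext_scale tn a x \<in> S" unfolding S_def by (rule range_eqI[of _ _ "\<lambda>m. a * c m"])
  qed
  moreover have "L \<subseteq> S"
  proof
    fix l assume "l \<in> L"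
    then obtain r where "l = (\<Sum>m\<in>M. tn (sc (r m) m) 1)" using span by blast
    then have "l = (\<Sum>m\<in>M. tn m (\<phi> (r m) * 1))" by (simp only: tn_scale_left)
    then show "l \<in> S" unfolding S_def by (rule range_eqI[of _ _ "\<lambda>m. \<phi> (r m) * 1"])
  qed
  ultimately have "T.span L \<subseteq> S" by (intro T.span_minimal)
  then have "Ls \<subseteq> S" using galois_descent[OF subspace_Ls Ls_stable] unfolding L_def by blast
  then have "\<exists>c. x = (\<Sum>m\<in>M. tn m (c m))" if "x \<in> Ls" for x using that unfolding S_def by blast
  then show thesis using that[OF fin _ span indep] M(1) by blast
qed

text \<open>The candidate isomorphism from the scalar extension of \<open>L\<close> to K^n, on pure
  tensors; it is the witness for \<open>etale_L\<close>.\<close>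

definition split_map :: "'t \<Rightarrow> 'k \<Rightarrow> 'k ^ 'n" where "split_map l c = (\<chi> i. c * \<xi> i l)"

lemma split_map_mult: "a \<in> L \<Longrightarrow> b \<in> L \<Longrightarrow> split_map a c * split_map b d = split_map (a * b) (c * d)"
  by (simp add: split_map_def vec_eq_iff xi_mult L_Ls)

lemma split_map_1: "split_map 1 c = vec c"
  by (simp add: split_map_def vec_eq_iff xi_1)

text \<open>By \<open>t_sum\<close>, a combination of the \<open>split_map\<close> values of a basis
  of \<open>L\<close> is the eigenvalue vector of the corresponding element of \<open>Ls\<close>.
  Elements of \<open>Ls\<close> are determined by their eigenvalues and every vector of eigenvalues
  occurs, so the criterion applies.\<close>

lemma tensor_algebra_L: "is_tensor_algebra \<phi> (restr_scale \<phi> tn) L split_map"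
proof (rule basis_L)
  fix M assume M: "finite M" "\<And>m. m \<in> M \<Longrightarrow> tn m 1 \<in> L"
    "\<And>l. l \<in> L \<Longrightarrow> \<exists>r. l = (\<Sum>m\<in>M. tn (sc (r m) m) 1)"
    "\<And>c. (\<Sum>m\<in>M. tn m (c m)) = 0 \<Longrightarrow> \<forall>m\<in>M. c m = 0"
    "\<And>x. x \<in> Ls \<Longrightarrow> \<exists>c. x = (\<Sum>m\<in>M. tn m (c m))"
  let ?M = "(\<lambda>m. tn m 1) ` M"
  have sum_M: "(\<Sum>m\<in>?M. f m) = (\<Sum>m\<in>M. f (tn m 1))" for f :: "'t \<Rightarrow> 'z::comm_monoid_add"
    using sum.reindex[OF inj_on_subset[OF inj_tn_1 subset_UNIV]] by simp
  have tn_Ls: "tn m c \<in> Ls" if "m \<in> M" for m c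
    using T.subspace_scale[OF subspace_Ls L_Ls[OF M(2)[OF that]], of c] by (simp add: ext_scale_tn)
  have xi_tn: "\<xi> i (tn m c) = c * \<xi> i (tn m 1)" if "m \<in> M" for i m c
    using xi_scale[OF L_Ls[OF M(2)[OF that]], of i c] by (simp add: ext_scale_tn)
  have t_sum: "(\<Sum>m\<in>?M. split_map m (c m)) = (\<chi> i. \<xi> i (\<Sum>m\<in>M. tn m (c (tn m 1))))" for c
  proof -
    have "\<xi> i (\<Sum>m\<in>M. tn m (c (tn m 1))) = (\<Sum>m\<in>M. c (tn m 1) * \<xi> i (tn m 1))" for i
    proof -
      have "\<xi> i (\<Sum>m\<in>M. tn m (c (tn m 1))) = (\<Sum>m\<in>M. \<xi> i (tn m (c (tn m 1))))"
        by (intro xi_sum tn_Ls)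
      also have "\<dots> = (\<Sum>m\<in>M. c (tn m 1) * \<xi> i (tn m 1))" by (intro sum.cong refl xi_tn)
      finally show ?thesis .
    qed
    then show ?thesis unfolding sum_M by (simp add: vec_eq_iff split_map_def)
  qed
  show ?thesis
  proof (rule tensor_algebra_from_basis[OF algebra_over_restr_scale phi _ _ subspace_L])
    show "finite ?M" "?M \<subseteq> L" using M by auto
    show "\<exists>r. l = (\<Sum>m\<in>?M. restr_scale \<phi> tn (r m) m)" if l: "l \<in> L" for l
    proof -
      obtain r where "l = (\<Sum>m\<in>M. tn (sc (r m) m) 1)" using M(3)[OF l] by blast
      \<comment> \<open>The inverse of the injection of A only reindexes the coefficients, from
        basis elements in A to their images in \<open>L\<close>.\<close>
      then have "l = (\<Sum>m\<in>M. restr_scale \<phi> tn (r (inv (\<lambda>a. tn a 1) (tn m 1))) (tn m 1))"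
        by (simp add: restr_scale_tn_1 inv_f_f[OF inj_tn_1])
      then have "l = (\<Sum>m\<in>?M. restr_scale \<phi> tn (r (inv (\<lambda>a. tn a 1) m)) m)" by (simp only: sum_M)
      then show ?thesis by (rule exI[of _ "\<lambda>m. r (inv (\<lambda>a. tn a 1) m)"])
    qed
    show "balanced \<phi> (restr_scale \<phi> tn) L split_map"
      unfolding balanced_def split_map_def
      by (auto simp: vec_eq_iff xi_add L_Ls algebra_simps restr_scale_eq xi_scale)
    show "split_map 1 1 = 1" by (simp add: split_map_1 vec_eq_iff)
    show "split_map a c * split_map b d = split_map (a * b) (c * d)" if "a \<in> L" "b \<in> L" for a b c d using that by (rule split_map_mult)
    show "\<forall>m\<in>?M. c m = 0" if "(\<Sum>m\<in>?M. split_map m (c m)) = 0" for c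
    proof -
      let ?x = "\<Sum>m\<in>M. tn m (c (tn m 1))"
      have "\<xi> i ?x = 0" for i using that unfolding t_sum by (simp add: vec_eq_iff)
      moreover have "?x \<in> Ls" by (intro T.subspace_sum[OF subspace_Ls] tn_Ls)
      ultimately have "?x = 0" by (intro Ls_eqI) (auto simp: xi_0 T.subspace_0[OF subspace_Ls])
      then show ?thesis using M(4)[of "\<lambda>m. c (tn m 1)"] by blast
    qed
    show "\<exists>c. x = (\<Sum>m\<in>?M. split_map m (c m))" for x
    proof -
      \<comment> \<open>The element of \<open>Ls\<close> whose eigenvalues are the prescribed
        coordinates of \<open>x\<close>.\<close>
      let ?y = "\<Sum>i\<in>UNIV. ext_scale tn (x $ i) (e i)"
      have y: "?y \<in> Ls" by (intro T.subspace_sum[OF subspace_Ls] T.subspace_scale[OF subspace_Ls] e_in_Ls)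
      have xi_y: "\<xi> j ?y = x $ j" for j
        by (subst xi_sum)
          (simp_all add: T.subspace_scale[OF subspace_Ls] e_in_Ls xi_scale xi_e if_distrib cong: if_cong)
      obtain c where c: "?y = (\<Sum>m\<in>M. tn m (c m))" using M(5)[OF y] by blast
      have "x = (\<chi> i. \<xi> i (\<Sum>m\<in>M. tn m (c (inv (\<lambda>a. tn a 1) (tn m 1)))))"
        by (simp add: vec_eq_iff inv_f_f[OF inj_tn_1] c[symmetric] xi_y)
      then have "x = (\<Sum>m\<in>?M. split_map m (c (inv (\<lambda>a. tn a 1) m)))" by (simp only: t_sum)
      then show ?thesis by (rule exI[of _ "\<lambda>m. c (inv (\<lambda>a. tn a 1) m)"])
    qed
  qed
qed

lemma etale_L: "etale_algebra TYPE('n) \<phi> (restr_scale \<phi> tn) L"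
  unfolding etale_algebra_def
  using algebra_over_restr_scale subalgebra_L Ls_commute L_Ls tensor_algebra_L split_map_1 by blast

section \<open>The points of \<open>L\<close> and the general embedding\<close>

definition frame_point :: "'n \<Rightarrow> 't \<Rightarrow> 'k" where "frame_point i = restrict (\<xi> i) L"

lemma frame_point_in_alg_points: "frame_point i \<in> alg_points \<phi> (restr_scale \<phi> tn) L"
proof -
  have "restr_scale \<phi> tn r x \<in> L" "x + y \<in> L" if "x \<in> L" "y \<in> L" for r x y
    using R.subspace_scale[OF subspace_L] R.subspace_add[OF subspace_L] that by auto
  then show ?thesis
    unfolding alg_points_def algebra_hom_on_def frame_point_def
    by (auto simp: L_1 L_mult L_Ls xi_1 xi_add xi_mult restr_scale_eq xi_scale)
qed

text \<open>A homomorphism from \<open>L\<close> to K extends to a multiplicative additive map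
  \<open>g\<close> on K^n. Its values at the coordinate idempotents sum to 1, so one of them is
  nonzero; as an idempotent of a field it equals 1, and that index is the one sought.\<close>

lemma alg_points_L: "alg_points \<phi> (restr_scale \<phi> tn) L = range frame_point"
proof
  show "range frame_point \<subseteq> alg_points \<phi> (restr_scale \<phi> tn) L" using frame_point_in_alg_points by blast
  show "alg_points \<phi> (restr_scale \<phi> tn) L \<subseteq> range frame_point"
  proof
    fix \<zeta> assume "\<zeta> \<in> alg_points \<phi> (restr_scale \<phi> tn) L"
    then have ext: "\<zeta> \<in> extensional L" and h: "\<zeta> 1 = 1" "\<And>x y. x \<in> L \<Longrightarrow> y \<in> L \<Longrightarrow> \<zeta> (x + y) = \<zeta> x + \<zeta> y"
      "\<And>x y. x \<in> L \<Longrightarrow> y \<in> L \<Longrightarrow> \<zeta> (x * y) = \<zeta> x * \<zeta> y"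
      "\<And>r x. x \<in> L \<Longrightarrow> \<zeta> (restr_scale \<phi> tn r x) = \<phi> r * \<zeta> x"
      by (auto simp: alg_points_def algebra_hom_on_def)
    have "balanced \<phi> (restr_scale \<phi> tn) L (\<lambda>l c. c * \<zeta> l)"
      unfolding balanced_def using h by (auto simp: algebra_simps)
    then obtain g :: "'k ^ 'n \<Rightarrow> 'k" where g: "Modules.additive g" and g_t: "\<And>l c. l \<in> L \<Longrightarrow> g (split_map l c) = c * \<zeta> l"
      using tensor_algebra_universal[OF tensor_algebra_L] by metis
    note induct = tensor_algebra_induct[OF tensor_algebra_L]
    have g_tt: "g (split_map l c * y) = g (split_map l c) * g y" if l: "l \<in> L" for l c y
    proof (induction y rule: induct)
      case (2 m d)
      then show ?case using l by (simp add: split_map_mult g_t L_mult h(3))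
    qed (simp_all add: additive.zero[OF g] additive.diff[OF g] right_diff_distrib)
    have g_mult: "g (x * y) = g x * g y" for x y
      by (induction x rule: induct)
        (simp_all add: additive.zero[OF g] additive.diff[OF g] left_diff_distrib g_tt)
    have "(\<Sum>i\<in>UNIV. axis i 1) = (split_map 1 1 :: 'k ^ 'n)"
      by (simp add: split_map_1 vec_eq_iff axis_def)
    then have "(\<Sum>i\<in>UNIV. g (axis i 1)) = 1"
      using g_t[OF L_1, of 1] h(1) additive.sum[OF g, of "\<lambda>i. axis i 1" UNIV] by simp
    then obtain i where i: "g (axis i 1) \<noteq> 0" by (metis sum.neutral zero_neq_one)
    have "axis i 1 * axis i 1 = (axis i 1 :: 'k ^ 'n)" by (simp add: vec_eq_iff axis_def)
    then have g_i: "g (axis i 1) = 1" using g_mult[of "axis i 1" "axis i 1"] i by simp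
    have "\<zeta> l = \<xi> i l" if l: "l \<in> L" for l
    proof -
      have "\<zeta> l = g (split_map l 1 * axis i 1)" by (simp add: g_mult g_i g_t l)
      \<comment> \<open>Multiplication by the idempotent erases all coordinates but the one at
        \<open>i\<close>, so the vector may be replaced by a constant one, on which \<open>g\<close>
        is known.\<close>
      also have "split_map l 1 * axis i 1 = split_map 1 (\<xi> i l) * axis i 1" by (simp add: vec_eq_iff xi_1 axis_def split_map_def)
      also have "g \<dots> = \<xi> i l" by (simp add: g_mult g_i g_t[OF L_1] h(1))
      finally show ?thesis .
    qed
    then have "\<zeta> = frame_point i" unfolding frame_point_def using ext by (intro extensionalityI[of _ L]) auto
    then show "\<zeta> \<in> range frame_point" by blast
  qed
qed

lemma Ls_span: "x \<in> Ls \<Longrightarrow> x \<in> T.span L"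
  using galois_descent[OF subspace_Ls Ls_stable] unfolding L_def by blast

text \<open>The eigenvector equations are given for \<open>L\<close>, whereas the conclusion needs
  the one for \<open>e i\<close>, which need not be fixed by the group. They extend K-linearly to
  the span of \<open>L\<close>, which contains \<open>e i\<close>; then x = e i * x lies in the
  right ideal.\<close>

lemma induced_embedding_frame_point:
  assumes \<epsilon>: "\<And>l. l \<in> L \<Longrightarrow> tn (\<epsilon> l) 1 = l"
  shows "induced_embedding tn L \<epsilon> (frame_point i) = I i"
proof
  show "I i \<subseteq> induced_embedding tn L \<epsilon> (frame_point i)"
    by (auto simp: induced_embedding_def frame_point_def \<epsilon> xi[OF L_Ls] ext_scale_def)
  show "induced_embedding tn L \<epsilon> (frame_point i) \<subseteq> I i"
  proof
    fix x assume "x \<in> induced_embedding tn L \<epsilon> (frame_point i)"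
    then have x: "l * x = ext_scale tn (\<xi> i l) x" if "l \<in> L" for l
      using that by (simp add: induced_embedding_def frame_point_def \<epsilon> ext_scale_def)
    \<comment> \<open>Membership in \<open>Ls\<close> is carried through the induction because the
      eigenvalue is linear only there.\<close>
    have "l \<in> Ls \<and> l * x = ext_scale tn (\<xi> i l) x" if "l \<in> T.span L" for l
      using that
    proof (induction rule: T.span_induct_alt)
      case base
      show ?case by (simp add: T.subspace_0[OF subspace_Ls] xi_0)
    next
      case (step c l y)
      then show ?case
        by (simp add: T.subspace_add[OF subspace_Ls] T.subspace_scale[OF subspace_Ls] L_Ls xi_add xi_scale
            distrib_right ext_scale_mult_left x T.scale_left_distrib)
    qed
    then have "e i * x = ext_scale tn (\<xi> i (e i)) x" using Ls_span[OF e_in_Ls] by blast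
    then have "x = e i * x" by (simp add: xi_e)
    then show "x \<in> I i" using I_right[OF e_in_I, of i x] by metis
  qed
qed

text \<open>Write \<open>e j\<close> as the image of some \<open>z\<close> in \<open>I i\<close> and
  apply the automorphism to the eigenvector equation of \<open>z\<close>: since \<open>l\<close> is
  fixed, the eigenvalue of \<open>l\<close> on \<open>I j\<close> is the conjugate of that on
  \<open>I i\<close>.\<close>

lemma frame_point_act:
  assumes g: "\<gamma> \<in> galois_group \<phi>" and j: "galois_act tn \<gamma> ` I i = I j"
  shows "compose L \<gamma> (frame_point i) = frame_point j"
proof (rule extensionalityI[of _ L])
  show "compose L \<gamma> (frame_point i) \<in> extensional L" "frame_point j \<in> extensional L"
    by (auto simp: compose_def frame_point_def)
  fix l assume l: "l \<in> L"
  obtain z where z: "z \<in> I i" "e j = galois_act tn \<gamma> z" using j e_in_I[of j] by blast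
  have "l * e j = galois_act tn \<gamma> (l * z)" using z L_fixed[OF l g] by (simp add: act_mult[OF g])
  also have "\<dots> = ext_scale tn (\<gamma> (\<xi> i l)) (e j)" using z by (simp add: xi[OF L_Ls[OF l]] act_scale[OF g])
  finally have "\<xi> j l = \<gamma> (\<xi> i l)" by (rule xi_unique[OF L_Ls[OF l]])
  then show "compose L \<gamma> (frame_point i) l = frame_point j l" using l by (simp add: compose_def frame_point_def)
qed

lemma general_embedding_L:
  assumes \<epsilon>: "\<And>l. l \<in> L \<Longrightarrow> tn (\<epsilon> l) 1 = l"
  shows "general_embedding \<phi> tn CARD('n) (alg_points \<phi> (restr_scale \<phi> tn) L)
    (\<lambda>\<gamma> \<zeta>. compose L \<gamma> \<zeta>) (induced_embedding tn L \<epsilon>)"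
proof -
  note ind = induced_embedding_frame_point[OF \<epsilon>]
  have frame_point_inj: "i = j" if "frame_point i = frame_point j" for i j using ind[of i] ind[of j] that I_inj by simp
  show ?thesis unfolding general_embedding_def alg_points_L
  proof (intro conjI ballI allI impI)
    show "finite (range frame_point)" by simp
    show "card (range frame_point) = CARD('n)" by (intro card_image injI frame_point_inj)
    show "induced_embedding tn L \<epsilon> ` range frame_point \<subseteq> SB_points tn CARD('n)"
      by (auto simp: ind SB_linear_def right_ideal_I dim_I)
    show "inj_on (induced_embedding tn L \<epsilon>) (range frame_point)"
      by (auto simp: inj_on_def ind dest: I_inj)
    fix \<gamma> \<zeta> assume g: "\<gamma> \<in> galois_group \<phi>" and "\<zeta> \<in> range frame_point"
    then obtain i where i: "\<zeta> = frame_point i" by blast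
    obtain j where j: "galois_act tn \<gamma> ` I i = I j" using act_I[OF g] by metis
    show "compose L \<gamma> \<zeta> \<in> range frame_point"
      "induced_embedding tn L \<epsilon> (compose L \<gamma> \<zeta>) = galois_act tn \<gamma> ` induced_embedding tn L \<epsilon> \<zeta>"
      by (simp_all add: i frame_point_act[OF g j] ind j)
  next
    fix k J assume J: "J \<in> SB_linear tn CARD('n) k" "J \<noteq> UNIV"
    show "\<not> (\<forall>\<zeta>\<in>range frame_point. induced_embedding tn L \<epsilon> \<zeta> \<subseteq> J)"
    proof
      assume "\<forall>\<zeta>\<in>range frame_point. induced_embedding tn L \<epsilon> \<zeta> \<subseteq> J"
      \<comment> \<open>A right ideal containing every \<open>I i\<close> contains their sum, which
        is the whole algebra.\<close>
      then have sub: "I i \<subseteq> J" for i by (simp add: ind)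
      have r: "0 \<in> J" "\<And>x y. x \<in> J \<Longrightarrow> y \<in> J \<Longrightarrow> x + y \<in> J"
        using J(1) by (auto simp: SB_linear_def right_ideal_def)
      have "(\<Sum>i\<in>S. x i) \<in> J" if "\<forall>i. x i \<in> I i" for x S
        using that sub by (induction S rule: infinite_finite_induct) (auto intro!: r)
      then have "{\<Sum>i\<in>UNIV. x i | x. \<forall>i. x i \<in> I i} \<subseteq> J" by blast
      then show False using sum_I J(2) by auto
    qed
  qed
qed

end

theorem proposition2p7:
  fixes \<phi> :: "'f::field \<Rightarrow> 'k::field"
    and scA :: "'f \<Rightarrow> 'a::ring_1 \<Rightarrow> 'a"
    and tn :: "'a \<Rightarrow> 'k \<Rightarrow> 't::ring_1"
    and I :: "'n::finite \<Rightarrow> 't set"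
    and Ls L :: "'t set"
    and \<epsilon> :: "'t \<Rightarrow> 'a"
  assumes "separable_closure \<phi>"
    and "central_simple_of_degree scA CARD('n)"
    and "is_tensor_algebra \<phi> scA UNIV tn"
    and "\<And>i. right_ideal (I i)"
    and "\<And>i. vector_space.dim (ext_scale tn) (I i) = CARD('n)"
    and "\<And>\<gamma>. \<gamma> \<in> galois_group \<phi> \<Longrightarrow> (\<lambda>J. galois_act tn \<gamma> ` J) ` range I \<subseteq> range I"
    and "{\<Sum>i\<in>UNIV. x i | x. \<forall>i. x i \<in> I i} = UNIV"
    and Ls: "Ls = {x. \<forall>i. \<forall>y\<in>I i. x * y \<in> I i}"
    and L: "L = galois_fixed \<phi> tn Ls"
    and \<epsilon>: "\<epsilon> = inv (\<lambda>a. tn a 1)"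
  shows "subalgebra (ext_scale tn) Ls \<and>
    (\<forall>\<gamma>\<in>galois_group \<phi>. galois_act tn \<gamma> ` Ls \<subseteq> Ls) \<and>
    etale_algebra TYPE('n) \<phi> (restr_scale \<phi> tn) L \<and>
    (\<forall>l\<in>L. tn (\<epsilon> l) 1 = l) \<and>
    inj_on \<epsilon> L \<and> algebra_hom_on (restr_scale \<phi> tn) scA L \<epsilon> \<and>
    general_embedding \<phi> tn CARD('n) (alg_points \<phi> (restr_scale \<phi> tn) L)
           (\<lambda>\<gamma> \<xi>. compose L \<gamma> \<xi>) (induced_embedding tn L \<epsilon>) \<and>
    induced_embedding tn L \<epsilon> ` alg_points \<phi> (restr_scale \<phi> tn) L = range I"
proof -
  have csa: "central_simple_algebra scA" and dim: "vector_space.dim scA (UNIV :: 'a set) = CARD('n)\<^sup>2"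
    using assms(2) by (auto simp: central_simple_of_degree_def)
  interpret base_change \<phi> scA tn
    using assms(1,3) csa by unfold_locales (auto simp: separable_closure_def central_simple_algebra_def)
  interpret projective_frame \<phi> scA tn I
  proof
    show "\<exists>B. finite B \<and> A.span B = UNIV" using csa by (simp add: central_simple_algebra_def)
  qed (use assms(1,4-7) csa dim in auto)
  have Ls_eq: "Ls = projective_frame.Ls I" unfolding Ls Ls_def ..
  have L_eq: "L = projective_frame.L \<phi> tn I" unfolding L Ls_eq L_def ..
  \<comment> \<open>By descent each element of \<open>L\<close> is of the form
    \<open>tn a 1\<close>, so the inverse of this injection recovers the inclusion of
    \<open>L\<close> in A.\<close>
  have tn_eps: "tn (\<epsilon> l) 1 = l" if "l \<in> projective_frame.L \<phi> tn I" for l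
    unfolding \<epsilon> by (rule L_tn[OF that]) (simp add: inv_f_f[OF inj_tn_1])
  have eps_tn: "\<epsilon> (tn a 1) = a" for a unfolding \<epsilon> by (simp add: inv_f_f[OF inj_tn_1])
  have "inj_on \<epsilon> (projective_frame.L \<phi> tn I)" using tn_eps by (metis inj_onI)
  moreover have "algebra_hom_on (restr_scale \<phi> tn) scA (projective_frame.L \<phi> tn I) \<epsilon>"
    unfolding algebra_hom_on_def
  proof (intro conjI ballI allI)
    show "\<epsilon> 1 = 1" using eps_tn[of 1] by (simp add: tn_1)
    fix x assume x: "x \<in> projective_frame.L \<phi> tn I"
    then obtain a where a: "x = tn a 1" by (rule L_tn)
    show "\<epsilon> (restr_scale \<phi> tn r x) = scA r (\<epsilon> x)" for r by (simp add: a restr_scale_tn_1 eps_tn)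
    fix y assume "y \<in> projective_frame.L \<phi> tn I"
    then obtain b where b: "y = tn b 1" by (rule L_tn)
    show "\<epsilon> (x + y) = \<epsilon> x + \<epsilon> y" by (simp add: a b eps_tn tn_add_left[symmetric])
    show "\<epsilon> (x * y) = \<epsilon> x * \<epsilon> y" by (simp add: a b eps_tn tn_mult)
  qed
  moreover have "induced_embedding tn (projective_frame.L \<phi> tn I) \<epsilon> `
      alg_points \<phi> (restr_scale \<phi> tn) (projective_frame.L \<phi> tn I) = range I"
    unfolding alg_points_L image_image using induced_embedding_frame_point[OF tn_eps] by simp
  ultimately show ?thesis
    unfolding L_eq unfolding Ls_eq
    using subalgebra_Ls etale_L general_embedding_L[OF tn_eps]
    by (intro conjI ballI image_subsetI Ls_stable tn_eps) assumption+
qed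

end
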